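(* Let $\xi$ be an expanding substitution on a finite alphabet $A$. Then there exists a positive power $\zeta=\xi^{s}$ ($s\ge 1$) such that for any non-empty word $w\in A^*$ and any letter $a_i\in A$ the limit frequency $$\lim_{t\to\infty}\frac{|\zeta^{t}(a_i)|_w}{|\zeta^{t}(a_i)|}$$ exists.
   Context: A substitution $\zeta$ on a finite alphabet $A$ assigns to every letter $a_i\in A$ a finite word $\zeta(a_i)\in A^*$, where $A^*$ is the free monoid over $A$; it extends to a monoid endomorphism $\zeta:A^*\to A^*$. For $u\in A^*$, $|u|$ is the length (number of letters) of $u$, and $|u|_w$ is the number of occurrences of the non-empty word $w$ as a factor (contiguous subword) of $u$. A substitution $\zeta$ is expanding if there is $k\ge 1$ such that $|\zeta^k(a_i)|\ge 2$ for every $a_i\in A$. *)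

theory Defs
  imports Complex_Main
begin

text \<open>The alphabet is a type \<open>'a\<close> of class \<open>finite\<close>; words are elements of the free
  monoid \<open>'a list\<close>. As the images may be any words, erasing substitutions are allowed.\<close>

type_synonym 'a substitution = "'a \<Rightarrow> 'a list"

text \<open>The unique extension of a substitution to a monoid endomorphism.\<close>

definition subst_ext :: "'a substitution \<Rightarrow> 'a list \<Rightarrow> 'a list" where
  "subst_ext \<zeta> u = concat (map \<zeta> u)"

text \<open>The power of a substitution, again regarded as a substitution, that is, as its restriction
  to letters.\<close>

definition subst_power :: "'a substitution \<Rightarrow> nat \<Rightarrow> 'a substitution" where
  "subst_power \<zeta> k a = (subst_ext \<zeta> ^^ k) [a]"

definition expanding :: "('a::finite) substitution \<Rightarrow> bool" where
  "expanding \<zeta> \<longleftrightarrow> (\<exists>k\<ge>1. \<forall>a. length (subst_power \<zeta> k a) \<ge> 2)"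

text \<open>Every position at which \<open>w\<close> occurs in \<open>u\<close> corresponds to one
  factorization of \<open>u\<close>; overlapping occurrences are counted separately.\<close>

definition occurrences :: "'a list \<Rightarrow> 'a list \<Rightarrow> nat" where
  "occurrences w u = card {(p, q). u = p @ w @ q}"

end

theory Submission
  imports Defs "HOL-Analysis.Uniform_Limit" "HOL-Analysis.Extended_Real_Limits"
    "HOL-Real_Asymp.Real_Asymp" "HOL-Computational_Algebra.Formal_Power_Series"
begin

text \<open>
  The number of letters \<open>b\<close> in \<open>\<zeta>\<^sup>t(a)\<close> is an entry of the \<open>t\<close>-th power of a nonnegative integer
  matrix, and the only obstruction to convergent letter frequencies is periodicity. It is removed
  by the choice of \<open>s\<close> (\<open>exists_loop_power\<close>): for each letter \<open>k\<close> that reappears in some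
  \<open>\<xi>\<^sup>l(k)\<close> fix one such \<open>l \<ge> 1\<close>, and let \<open>s\<close> be a common multiple of these. For \<open>\<zeta> = \<xi>\<^sup>s\<close>
  every letter that lies on a cycle at all then lies on a cycle of length one.

  For a nonnegative matrix with this loop property each entry of the \<open>t\<close>-th power either vanishes
  for large \<open>t\<close> or is asymptotic to \<open>c t\<^sup>d \<beta>\<^sup>t\<close> with \<open>c > 0\<close>. This replaces Perron-Frobenius theory
  and is proved by Kleene's elimination (\<open>walks_elimination\<close>): the generating function of the walks
  between two vertices is built from single edges by sums, products and the geometric series
  \<open>1 / (1 - f)\<close>, where \<open>f\<close> counts closed walks at one vertex. Sums and products preserve the class of
  sequences above (\<open>regular_growth_add\<close>, \<open>regular_growth_convolution\<close>). For \<open>1 / (1 - f)\<close> a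
  renewal theorem is needed (\<open>regular_growth_geometric_inverse\<close>): if \<open>\<rho>\<close> is the positive root of
  \<open>f(\<rho>) = 1\<close>, the coefficients multiplied by \<open>\<rho>\<^sup>n\<close> solve the renewal equation with step
  distribution \<open>f\<^sub>n \<rho>\<^sup>n\<close>, and they converge because the loop property gives step one positive
  probability. Two sequences of the class are always comparable in growth, so a ratio bounded
  by \<open>1\<close> converges; hence the letter frequencies exist.

  For a factor \<open>w\<close>, split \<open>\<zeta>\<^bsup>m+t\<^esup>(a)\<close> into the words \<open>\<zeta>\<^sup>m(c)\<close>, with \<open>c\<close> running over the letters of
  \<open>\<zeta>\<^sup>t(a)\<close>. The occurrences inside these blocks depend on the letter counts of \<open>\<zeta>\<^sup>t(a)\<close> only, and
  at most \<open>\<bar>w\<bar>\<close> occurrences straddle each block boundary. Since \<open>\<zeta>\<close> is expanding, the blocks are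
  long for large \<open>m\<close>, so the boundary terms are a small fraction of the length, uniformly in \<open>t\<close>.
  Thus the frequency of \<open>w\<close> is a uniform limit of convergent sequences (\<open>factor_frequencies_converge\<close>).
  The same \<open>s\<close> serves all \<open>w\<close>, because only the letter frequencies constrain it.
\<close>

unbundle no vec_syntax
unbundle fps_syntax

section \<open>Limits of convolution sums\<close>

text \<open>Tannery's theorem for sums that are cut off at a moving index \<open>m j\<close>.
  Convolutions need it with \<open>m n = n\<close>, the renewal theorem with \<open>m\<close> a
  sequence of indices tending to infinity.\<close>

lemma tannery_sum:
  fixes a :: "nat \<Rightarrow> nat \<Rightarrow> real"
  assumes lim: "\<And>k. (\<lambda>j. a k j) \<longlonglongrightarrow> b k"
    and bound: "\<And>k j. k \<le> m j \<Longrightarrow> \<bar>a k j\<bar> \<le> M k"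
    and M: "summable M"
    and m: "filterlim m at_top sequentially"
  shows "(\<lambda>j. \<Sum>k\<le>m j. a k j) \<longlonglongrightarrow> suminf b"
proof -
  define a' where "a' k j = (if k \<le> m j then a k j else 0)" for k j
  have ev: "eventually (\<lambda>j. k \<le> m j) sequentially" for k
    using m by (simp add: filterlim_at_top)
  have M0: "0 \<le> M k" for k
  proof -
    obtain j where "k \<le> m j" using eventually_happens[OF ev[of k]] by auto
    then show ?thesis using bound[of k j] by linarith
  qed
  have "(\<lambda>j. a' k j) \<longlonglongrightarrow> b k" for k
    using lim[of k] by (rule Lim_transform_eventually)
      (use ev[of k] in \<open>auto elim: eventually_mono simp: a'_def\<close>)
  moreover have "eventually (\<lambda>(k, j). norm (a' k j) \<le> M k) (at_top \<times>\<^sub>F sequentially)"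
    using bound M0 by (intro always_eventually) (auto simp: a'_def)
  ultimately have "(\<lambda>j. suminf (\<lambda>k. a' k j)) \<longlonglongrightarrow> suminf b"
    using tannerys_theorem[of a' b sequentially M] M by simp
  moreover have "suminf (\<lambda>k. a' k j) = (\<Sum>k\<le>m j. a k j)" for j
    using suminf_finite[of "{..m j}" "\<lambda>k. a' k j"] by (simp add: a'_def)
  ultimately show ?thesis by simp
qed

text \<open>Only the finitely many early terms of \<open>z\<close> are not small, and their weights
  fade.\<close>

lemma weighted_average_null:
  fixes w :: "nat \<Rightarrow> nat \<Rightarrow> real"
  assumes nonneg: "\<And>n k. 0 \<le> w n k"
    and total: "\<And>n. (\<Sum>k\<le>n. w n k) \<le> 1"
    and fade: "\<And>k. (\<lambda>n. w n k) \<longlonglongrightarrow> 0"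
    and z: "z \<longlonglongrightarrow> 0"
  shows "(\<lambda>n. \<Sum>k\<le>n. w n k * z k) \<longlonglongrightarrow> (0::real)"
proof (rule LIMSEQ_I)
  fix \<epsilon> :: real assume "0 < \<epsilon>"
  then obtain N where N: "\<And>k. k \<ge> N \<Longrightarrow> \<bar>z k\<bar> < \<epsilon> / 2"
    using LIMSEQ_D[OF z, of "\<epsilon> / 2"] by auto
  have "(\<lambda>n. \<Sum>k<N. w n k * \<bar>z k\<bar>) \<longlonglongrightarrow> (\<Sum>k<N. 0 * \<bar>z k\<bar>)"
    by (intro tendsto_intros fade)
  then obtain N' where N': "\<And>n. n \<ge> N' \<Longrightarrow> \<bar>\<Sum>k<N. w n k * \<bar>z k\<bar>\<bar> < \<epsilon> / 2"
    using LIMSEQ_D[of "\<lambda>n. \<Sum>k<N. w n k * \<bar>z k\<bar>" 0 "\<epsilon> / 2"] \<open>0 < \<epsilon>\<close> by auto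
  show "\<exists>no. \<forall>n\<ge>no. norm ((\<Sum>k\<le>n. w n k * z k) - 0) < \<epsilon>"
  proof (intro exI[of _ "max N N'"] allI impI)
    fix n assume n: "max N N' \<le> n"
    have "\<bar>\<Sum>k\<le>n. w n k * z k\<bar> \<le> (\<Sum>k\<le>n. w n k * \<bar>z k\<bar>)"
      using sum_abs[of "\<lambda>k. w n k * z k" "{..n}"] nonneg by (simp add: abs_mult)
    also have "\<dots> = (\<Sum>k\<in>{..<N} \<union> {N..n}. w n k * \<bar>z k\<bar>)"
      using n by (intro sum.cong) auto
    also have "\<dots> = (\<Sum>k<N. w n k * \<bar>z k\<bar>) + (\<Sum>k\<in>{N..n}. w n k * \<bar>z k\<bar>)"
      by (rule sum.union_disjoint) auto
    also have "(\<Sum>k\<in>{N..n}. w n k * \<bar>z k\<bar>) \<le> (\<Sum>k\<in>{N..n}. w n k * (\<epsilon> / 2))"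
      using N nonneg by (intro sum_mono mult_left_mono) (auto simp: less_imp_le)
    also have "\<dots> \<le> (\<Sum>k\<le>n. w n k * (\<epsilon> / 2))"
      using nonneg \<open>0 < \<epsilon>\<close> by (intro sum_mono2) auto
    also have "\<dots> \<le> \<epsilon> / 2"
      using mult_right_mono[OF total[of n], of "\<epsilon> / 2"] \<open>0 < \<epsilon>\<close>
      unfolding sum_distrib_right by simp
    finally show "norm ((\<Sum>k\<le>n. w n k * z k) - 0) < \<epsilon>"
      using N'[of n] n by simp
  qed
qed

section \<open>Asymptotic scales\<close>

text \<open>Asymptotically a constant multiple of \<open>n\<^sup>d \<beta>\<^sup>n\<close>. With the
  binomial coefficient in place of \<open>n\<^sup>d\<close> it consists of the coefficients of
  \<open>(1 - \<beta>X)\<^bsup>-(d+1)\<^esup>\<close>, so that the convolution of two scales with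
  the same \<open>\<beta>\<close> is exactly a scale again.\<close>

definition growth :: "real \<Rightarrow> nat \<Rightarrow> nat \<Rightarrow> real" where
  "growth \<beta> d n = real ((d + n) choose d) * \<beta> ^ n"

lemma growth_pos: "0 < \<beta> \<Longrightarrow> 0 < growth \<beta> d n"
  by (simp add: growth_def)

lemma fps_geometric_power_nth:
  "(Abs_fps (\<lambda>_. 1 :: real) ^ Suc d) $ n = real ((d + n) choose d)"
proof (induction d arbitrary: n)
  case (Suc d)
  have "(Abs_fps (\<lambda>_. 1 :: real) ^ Suc (Suc d)) $ n
      = (\<Sum>i=0..n. (Abs_fps (\<lambda>_. 1 :: real) ^ Suc d) $ i)"
    by (subst power_Suc2) (simp only: fps_mult_nth fps_nth_Abs_fps mult_1_right)
  also have "\<dots> = real (\<Sum>i\<le>n. (d + i) choose d)"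
    by (simp only: Suc.IH of_nat_sum atLeast0AtMost)
  finally show ?case by (simp only: choose_rising_sum) simp
qed simp

text \<open>Multiplication of the power series \<open>(1 - X)\<^bsup>-(d+1)\<^esup>\<close> and
  \<open>(1 - X)\<^bsup>-(e+1)\<^esup>\<close>, rescaled by \<open>\<beta>\<close>.\<close>

lemma growth_convolution:
  "(\<Sum>k\<le>n. growth \<beta> d k * growth \<beta> e (n - k)) = growth \<beta> (Suc (d + e)) n"
proof -
  have "(\<Sum>k\<le>n. real ((d + k) choose d) * real ((e + (n - k)) choose e))
      = (Abs_fps (\<lambda>_. 1 :: real) ^ (Suc d + Suc e)) $ n"
    unfolding power_add fps_mult_nth by (simp only: fps_geometric_power_nth atLeast0AtMost)
  also have "\<dots> = real ((Suc (d + e) + n) choose Suc (d + e))"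
    using fps_geometric_power_nth[of "Suc (d + e)" n] by simp
  finally have *: "(\<Sum>k\<le>n. real ((d + k) choose d) * real ((e + (n - k)) choose e))
      = real ((Suc (d + e) + n) choose Suc (d + e))" .
  have "(\<Sum>k\<le>n. growth \<beta> d k * growth \<beta> e (n - k))
      = (\<Sum>k\<le>n. real ((d + k) choose d) * real ((e + (n - k)) choose e) * \<beta> ^ n)"
    by (intro sum.cong refl) (auto simp: growth_def power_add[symmetric] mult_ac)
  then show ?thesis unfolding sum_distrib_right[symmetric] * growth_def .
qed

lemma ratio_eq_of_cross:
  fixes a b c d :: real
  assumes "c * a = b * d" "b \<noteq> 0" "c \<noteq> 0"
  shows "a / b = d / c"
  using assms by (simp add: frac_eq_eq mult.commute)

lemma binomial_ratio_step:
  "real ((d + n) choose d) / real ((d + Suc n) choose d) = real (Suc n) / real (Suc (d + n))"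
proof -
  have "Suc (d + n) * ((d + n) choose d) = ((d + Suc n) choose d) * Suc n"
    using Suc_times_binomial_eq[of "d + n" n] binomial_symmetric[of d "d + n"]
      binomial_symmetric[of d "d + Suc n"] by (simp del: binomial_Suc_Suc)
  then have "real (Suc (d + n)) * real ((d + n) choose d) = real ((d + Suc n) choose d) * real (Suc n)"
    by (metis of_nat_mult)
  then show ?thesis by (rule ratio_eq_of_cross) simp_all
qed

lemma binomial_ratio_step_tendsto:
  "(\<lambda>n. real ((d + n) choose d) / real ((d + Suc n) choose d)) \<longlonglongrightarrow> 1"
  unfolding binomial_ratio_step by real_asymp

text \<open>Polynomial factors do not notice a bounded shift of the index; this makes Tannery's
  theorem applicable to convolutions.\<close>

lemma binomial_shift_ratio_tendsto:
  "(\<lambda>n. real ((d + (n - k)) choose d) / real ((d + n) choose d)) \<longlonglongrightarrow> 1"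
proof -
  have "(\<lambda>n. real ((d + n) choose d) / real ((d + (n + k)) choose d)) \<longlonglongrightarrow> 1"
  proof (induction k)
    case (Suc k)
    from tendsto_mult[OF Suc LIMSEQ_ignore_initial_segment[OF binomial_ratio_step_tendsto[of d], of k]]
    show ?case by (simp del: binomial_Suc_Suc)
  qed simp
  then show ?thesis
    using LIMSEQ_offset[where k = k and a = 1
        and f = "\<lambda>n. real ((d + (n - k)) choose d) / real ((d + n) choose d)"]
    by (simp only: diff_add_inverse2)
qed

lemma summable_binomial_geometric:
  assumes "0 \<le> r" "r < 1"
  shows "summable (\<lambda>n. real ((d + n) choose d) * r ^ n)"
proof (cases "r = 0")
  case False
  define c where "c = (1 + r) / 2"
  have c: "r < c" "c < 1" using assms by (auto simp: c_def)
  have "r / c < 1" using c assms by auto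
  from order_tendstoD(1)[OF binomial_ratio_step_tendsto this, of d]
  obtain N where N: "\<And>n. n \<ge> N \<Longrightarrow> r / c < real ((d + n) choose d) / real ((d + Suc n) choose d)"
    unfolding eventually_sequentially by blast
  have cross: "r * b \<le> c * a" if "r / c < a / b" "0 < b" for a b :: real
    using that c assms by (simp add: field_simps)
  show ?thesis
  proof (rule summable_ratio_test[OF c(2)])
    fix n assume "n \<ge> N"
    have "r * real ((d + Suc n) choose d) \<le> c * real ((d + n) choose d)"
      by (rule cross[OF N[OF \<open>n \<ge> N\<close>]]) simp
    from mult_right_mono[OF this, of "r ^ n"] assms
    have "real ((d + Suc n) choose d) * (r * r ^ n) \<le> c * (real ((d + n) choose d) * r ^ n)"
      by (simp only: mult_ac zero_le_power)
    then show "norm (real ((d + Suc n) choose d) * r ^ Suc n) \<le> c * norm (real ((d + n) choose d) * r ^ n)"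
      using assms by (simp only: power_Suc real_norm_def abs_mult abs_of_nat abs_of_nonneg zero_le_power)
  qed
next
  case True
  then show ?thesis by (intro summable_finite[of "{0}"]) auto
qed

text \<open>The scales are ordered lexicographically, first by \<open>\<beta>\<close> and then by
  \<open>d\<close>, and a smaller one is negligible against a larger one.\<close>

lemma growth_dominated:
  assumes "0 < \<beta>" "\<beta> < \<mu> \<or> \<beta> = \<mu> \<and> d < e"
  shows "(\<lambda>n. growth \<beta> d n / growth \<mu> e n) \<longlonglongrightarrow> 0"
  using assms(2)
proof
  assume "\<beta> < \<mu>"
  show ?thesis
  proof (rule tendsto_sandwich[of "\<lambda>_. 0" _ _ "\<lambda>n. real ((d + n) choose d) * (\<beta> / \<mu>) ^ n"])
    show "(\<lambda>n. real ((d + n) choose d) * (\<beta> / \<mu>) ^ n) \<longlonglongrightarrow> 0"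
      using \<open>\<beta> < \<mu>\<close> assms(1) by (intro summable_LIMSEQ_zero summable_binomial_geometric) auto
    have "growth \<beta> d n / growth \<mu> e n \<le> real ((d + n) choose d) * (\<beta> / \<mu>) ^ n" for n
    proof -
      have "0 < (e + n) choose e" by simp
      then have "1 \<le> real ((e + n) choose e)" by linarith
      moreover have "0 \<le> real ((d + n) choose d) * (\<beta> / \<mu>) ^ n"
        using assms(1) \<open>\<beta> < \<mu>\<close> by simp
      ultimately have "real ((d + n) choose d) * (\<beta> / \<mu>) ^ n / real ((e + n) choose e)
          \<le> real ((d + n) choose d) * (\<beta> / \<mu>) ^ n / 1"
        by (intro divide_left_mono) auto
      then show ?thesis by (simp add: growth_def power_divide mult.commute)
    qed
    then show "\<forall>\<^sub>F n in sequentially. growth \<beta> d n / growth \<mu> e n \<le> real ((d + n) choose d) * (\<beta> / \<mu>) ^ n"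
      by simp
    show "\<forall>\<^sub>F n in sequentially. 0 \<le> growth \<beta> d n / growth \<mu> e n"
      using assms(1) \<open>\<beta> < \<mu>\<close> by (intro always_eventually) (simp add: growth_def)
  qed simp
next
  assume *: "\<beta> = \<mu> \<and> d < e"
  have step: "real ((i + n) choose i) / real ((Suc i + n) choose Suc i) = real (Suc i) / real (Suc i + n)" for i n
  proof -
    have "real (Suc (i + n)) * real ((i + n) choose i) = real ((Suc i + n) choose Suc i) * real (Suc i)"
      using Suc_times_binomial_eq[of "i + n" i] by (metis of_nat_mult add_Suc)
    then show ?thesis unfolding add_Suc by (rule ratio_eq_of_cross) (simp_all del: binomial_Suc_Suc)
  qed
  have "(\<lambda>n. real ((d + n) choose d) / real ((Suc (d + i) + n) choose Suc (d + i))) \<longlonglongrightarrow> 0" for i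
  proof (induction i)
    case 0
    show ?case unfolding add_0_right step by real_asymp
  next
    case (Suc i)
    define b where "b j n = real ((j + n) choose j)" for j n
    have b: "b j n \<noteq> 0" for j n by (simp add: b_def)
    have "(\<lambda>n. b (Suc (d + i)) n / b (Suc (Suc (d + i))) n) \<longlonglongrightarrow> 0"
      unfolding b_def step by real_asymp
    from tendsto_mult[OF Suc[folded b_def] this]
    have "(\<lambda>n. b d n / b (Suc (Suc (d + i))) n) \<longlonglongrightarrow> 0"
      using b by simp
    then show ?case by (simp only: b_def add_Suc_right)
  qed
  moreover obtain i where "e = Suc (d + i)" using * less_iff_Suc_add by blast
  ultimately have "(\<lambda>n. real ((d + n) choose d) / real ((e + n) choose e)) \<longlonglongrightarrow> 0"
    by blast
  then show ?thesis using * assms(1) by (simp add: growth_def)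
qed

section \<open>Sequences of regular growth\<close>

text \<open>The shape of the entries of powers of a nonnegative matrix whose cycles pass only
  through vertices with a loop. Members are pairwise comparable in growth, which is what makes their
  ratios converge. Nonnegativity is part of the definition because it excludes cancellation of
  leading terms, on which closure under sums and products rests.\<close>

definition regular_growth :: "(nat \<Rightarrow> real) \<Rightarrow> bool" where
  "regular_growth x \<longleftrightarrow> (\<forall>n. 0 \<le> x n) \<and>
     (eventually (\<lambda>n. x n = 0) sequentially \<or>
      (\<exists>c \<beta> d. 0 < c \<and> 0 < \<beta> \<and> (\<lambda>n. x n / growth \<beta> d n) \<longlonglongrightarrow> c))"

lemma regular_growthI:
  "(\<And>n. 0 \<le> x n) \<Longrightarrow> 0 < c \<Longrightarrow> 0 < \<beta> \<Longrightarrow> (\<lambda>n. x n / growth \<beta> d n) \<longlonglongrightarrow> c \<Longrightarrow> regular_growth x"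
  unfolding regular_growth_def by blast

lemma regular_growth_finite:
  "(\<And>n. 0 \<le> x n) \<Longrightarrow> (\<And>n. N \<le> n \<Longrightarrow> x n = 0) \<Longrightarrow> regular_growth x"
  unfolding regular_growth_def eventually_sequentially by blast

lemma regular_growth_nonneg: "regular_growth x \<Longrightarrow> 0 \<le> x n"
  by (simp add: regular_growth_def)

lemma regular_growth_cases:
  assumes "regular_growth x"
  obtains (finite) N where "\<And>n. N \<le> n \<Longrightarrow> x n = 0"
  | (growing) c \<beta> d where "0 < c" "0 < \<beta>" "(\<lambda>n. x n / growth \<beta> d n) \<longlonglongrightarrow> c"
  using assms unfolding regular_growth_def eventually_sequentially by blast

lemma growth_change_scale:
  assumes "0 < \<beta>" "\<beta> < \<mu> \<or> \<beta> = \<mu> \<and> d < e" "(\<lambda>n. x n / growth \<beta> d n) \<longlonglongrightarrow> c"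
  shows "(\<lambda>n. x n / growth \<mu> e n) \<longlonglongrightarrow> 0"
proof -
  have "(\<lambda>n. x n / growth \<beta> d n * (growth \<beta> d n / growth \<mu> e n)) \<longlonglongrightarrow> c * 0"
    by (intro tendsto_mult growth_dominated assms)
  moreover have "growth \<beta> d n \<noteq> 0" for n using growth_pos[OF assms(1), of d n] by simp
  ultimately show ?thesis by simp
qed

lemma growth_scale_cases:
  fixes \<beta> \<mu> :: real and d e :: nat
  obtains "\<beta> = \<mu>" "d = e" | "\<beta> < \<mu> \<or> \<beta> = \<mu> \<and> d < e" | "\<mu> < \<beta> \<or> \<mu> = \<beta> \<and> e < d"
  by linarith

text \<open>The larger scale wins; if the scales agree, the leading coefficients add up to a
  positive number.\<close>

lemma regular_growth_add:
  assumes x: "regular_growth x" and y: "regular_growth y"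
  shows "regular_growth (\<lambda>n. x n + y n)"
proof -
  have nonneg: "0 \<le> x n + y n" for n using x y by (simp add: regular_growth_nonneg)
  have finite_add: "regular_growth (\<lambda>n. u n + v n)"
    if u: "\<And>n. N \<le> n \<Longrightarrow> u n = 0" and v: "regular_growth v" and nn: "\<And>n. 0 \<le> u n + v n" for u v N
    using v
  proof (cases rule: regular_growth_cases)
    case (finite N')
    then show ?thesis using u nn by (intro regular_growth_finite[of _ "max N N'"]) auto
  next
    case (growing c \<beta> d)
    have "(\<lambda>n. (u n + v n) / growth \<beta> d n) \<longlonglongrightarrow> c"
      using growing(3) by (rule Lim_transform_eventually)
        (use u in \<open>auto simp: eventually_sequentially intro!: exI[of _ N]\<close>)
    then show ?thesis using growing nn by (intro regular_growthI[of _ c \<beta> d]) auto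
  qed
  show ?thesis
  proof (cases rule: regular_growth_cases[OF x])
    case (1 N)
    then show ?thesis using finite_add[of N x y] y nonneg by blast
  next
    case x': (2 c \<beta> d)
    show ?thesis
    proof (cases rule: regular_growth_cases[OF y])
      case (1 N)
      then show ?thesis using finite_add[of N y x] x nonneg by (simp add: add.commute)
    next
      case y': (2 c' \<mu> e)
      show ?thesis
      proof (cases rule: growth_scale_cases[of \<beta> \<mu> d e])
        case 1
        then show ?thesis using tendsto_add[OF x'(3) y'(3)[folded 1]] x' y' nonneg
          by (intro regular_growthI[of _ "c + c'" \<beta> d]) (auto simp: add_divide_distrib)
      next
        case 2
        from tendsto_add[OF growth_change_scale[OF x'(2) 2 x'(3)] y'(3)]
        show ?thesis using y' nonneg
          by (intro regular_growthI[of _ c' \<mu> e]) (auto simp: add_divide_distrib)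
      next
        case 3
        from tendsto_add[OF x'(3) growth_change_scale[OF y'(2) 3 y'(3)]]
        show ?thesis using x' nonneg
          by (intro regular_growthI[of _ c \<beta> d]) (auto simp: add_divide_distrib)
      qed
    qed
  qed
qed

lemma regular_growth_sum:
  "finite S \<Longrightarrow> (\<And>i. i \<in> S \<Longrightarrow> regular_growth (x i)) \<Longrightarrow> regular_growth (\<lambda>n. \<Sum>i\<in>S. x i n)"
  by (induction S rule: finite_induct)
    (auto intro!: regular_growth_add regular_growth_finite[of "\<lambda>_. 0" 0])

text \<open>The hypothesis \<open>x \<le> y\<close> excludes that \<open>x\<close> lives on a larger
  scale than \<open>y\<close>, the only case in which the ratio would diverge.\<close>

lemma regular_growth_ratio_convergent:
  assumes x: "regular_growth x" and y: "regular_growth y"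
    and le: "\<And>n. x n \<le> y n" and pos: "\<And>n. 0 < y n"
  shows "convergent (\<lambda>n. x n / y n)"
proof (cases rule: regular_growth_cases[OF x])
  case (1 N)
  have "(\<lambda>n. x n / y n) \<longlonglongrightarrow> 0"
    using 1 by (intro tendsto_eventually) (auto simp: eventually_sequentially)
  then show ?thesis by (rule convergentI)
next
  case x': (2 c \<beta> d)
  show ?thesis
  proof (cases rule: regular_growth_cases[OF y])
    case (1 N)
    then show ?thesis using pos[of N] by simp
  next
    case y': (2 c' \<mu> e)
    have g: "growth \<mu> e n \<noteq> 0" for n using growth_pos[OF y'(2), of e n] by simp
    have lim: "convergent (\<lambda>n. x n / y n)" if "(\<lambda>n. x n / growth \<mu> e n) \<longlonglongrightarrow> b" for b
      using tendsto_divide[OF that y'(3)] y'(1) g by (auto intro: convergentI)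
    show ?thesis
    proof (cases rule: growth_scale_cases[of \<beta> \<mu> d e])
      case 1
      then show ?thesis using lim x' by blast
    next
      case 2
      then show ?thesis using lim growth_change_scale x' by blast
    next
      case 3
      from growth_change_scale[OF y'(2) 3 y'(3)] have "(\<lambda>n. y n / growth \<beta> d n) \<longlonglongrightarrow> 0" .
      moreover have "x n / growth \<beta> d n \<le> y n / growth \<beta> d n" for n
        using le growth_pos[OF x'(2), of d n] by (simp add: divide_right_mono)
      ultimately have "c \<le> 0" using x'(3) by (intro LIMSEQ_le[of _ c _ 0]) auto
      then show ?thesis using x' by simp
    qed
  qed
qed

text \<open>If \<open>y\<close> is summable against \<open>\<beta>\<^bsup>-n\<^esup>\<close>, the
  sum is governed by the terms with small \<open>k\<close>, where \<open>x (n - k)\<close> is close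
  to \<open>\<beta>\<^bsup>-k\<^esup> x n\<close>: the convolution inherits the scale of
  \<open>x\<close>, multiplied by the total mass of \<open>y\<close>.\<close>

lemma convolution_limit_summable:
  assumes \<beta>: "0 < \<beta>" and x: "(\<lambda>n. x n / growth \<beta> d n) \<longlonglongrightarrow> c"
    and y: "summable (\<lambda>n. \<bar>y n\<bar> / \<beta> ^ n)"
  shows "(\<lambda>n. (\<Sum>k\<le>n. y k * x (n - k)) / growth \<beta> d n) \<longlonglongrightarrow> (\<Sum>n. y n / \<beta> ^ n * c)"
proof -
  have g: "0 < growth \<beta> d n" for n using \<beta> by (rule growth_pos)
  obtain K where K: "\<And>n. \<bar>x n / growth \<beta> d n\<bar> \<le> K"
    using convergent_imp_Bseq[OF convergentI[OF x]] by (auto simp: Bseq_def)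
  define \<rho> where "\<rho> k n = growth \<beta> d (n - k) / growth \<beta> d n * \<beta> ^ k" for k n
  have \<rho>_eq: "\<rho> k n = real ((d + (n - k)) choose d) / real ((d + n) choose d)" if "k \<le> n" for k n
  proof -
    have "\<beta> ^ (n - k) * \<beta> ^ k = \<beta> ^ n" using that by (simp flip: power_add)
    then show ?thesis using \<beta> by (simp add: \<rho>_def growth_def mult.assoc)
  qed
  have "(\<lambda>n. \<Sum>k\<le>n. y k / \<beta> ^ k * (x (n - k) / growth \<beta> d (n - k)) * \<rho> k n)
      \<longlonglongrightarrow> (\<Sum>k. y k / \<beta> ^ k * c * 1)"
  proof (rule tannery_sum[where m = "\<lambda>n. n" and M = "\<lambda>k. \<bar>y k\<bar> / \<beta> ^ k * K"])
    fix k
    have "\<rho> k \<longlonglongrightarrow> 1"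
      using binomial_shift_ratio_tendsto[of d k] by (rule Lim_transform_eventually)
        (auto simp: eventually_sequentially \<rho>_eq intro!: exI[of _ k])
    moreover have "(\<lambda>n. x (n - k) / growth \<beta> d (n - k)) \<longlonglongrightarrow> c"
      by (rule LIMSEQ_offset[of _ k]) (use x in simp)
    ultimately show "(\<lambda>n. y k / \<beta> ^ k * (x (n - k) / growth \<beta> d (n - k)) * \<rho> k n)
        \<longlonglongrightarrow> y k / \<beta> ^ k * c * 1"
      by (intro tendsto_intros)
  next
    fix k n :: nat assume kn: "k \<le> n"
    have "(d + (n - k)) choose d \<le> (d + n) choose d" by (intro binomial_right_mono) simp
    then have "\<bar>\<rho> k n\<bar> \<le> 1" using kn by (simp add: \<rho>_eq)
    moreover have "0 \<le> K" using K[of 0] by linarith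
    ultimately have "\<bar>y k\<bar> / \<beta> ^ k * \<bar>x (n - k) / growth \<beta> d (n - k)\<bar> * \<bar>\<rho> k n\<bar> \<le> \<bar>y k\<bar> / \<beta> ^ k * K * 1"
      using \<beta> K by (intro mult_mono) auto
    then show "\<bar>y k / \<beta> ^ k * (x (n - k) / growth \<beta> d (n - k)) * \<rho> k n\<bar> \<le> \<bar>y k\<bar> / \<beta> ^ k * K"
      using \<beta> by (simp add: abs_mult)
  qed (rule summable_mult2[OF y], rule filterlim_ident)
  moreover have "y k / \<beta> ^ k * (x (n - k) / growth \<beta> d (n - k)) * \<rho> k n
      = y k * x (n - k) / growth \<beta> d n" for k n
    using \<beta> g[of "n - k"] by (simp add: \<rho>_def)
  ultimately show ?thesis by (simp add: sum_divide_distrib)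
qed

text \<open>After division by the scales the convolution becomes a weighted average of the products
  \<open>x' k * y' (n - k)\<close>. The weights add up to \<open>1\<close> by
  \<open>growth_convolution\<close>, and they fade both for fixed \<open>k\<close> and for fixed
  \<open>n - k\<close>, so that in most of the mass both factors are near their limits.\<close>

lemma convolution_limit_same_rate:
  assumes \<beta>: "0 < \<beta>" and x: "(\<lambda>n. x n / growth \<beta> d n) \<longlonglongrightarrow> c"
    and y: "(\<lambda>n. y n / growth \<beta> e n) \<longlonglongrightarrow> c'"
  shows "(\<lambda>n. (\<Sum>k\<le>n. x k * y (n - k)) / growth \<beta> (Suc (d + e)) n) \<longlonglongrightarrow> c * c'"
proof -
  define w where "w d e n k = (if k \<le> n then growth \<beta> d k * growth \<beta> e (n - k) / growth \<beta> (Suc (d + e)) n else 0)"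
    for d e n k
  have g: "0 < growth \<beta> d n" "growth \<beta> d n \<noteq> 0" for d n
    using growth_pos[OF \<beta>, of d n] by auto
  have w_nonneg: "0 \<le> w d e n k" for d e n k using g by (simp add: w_def less_imp_le)
  have w_total: "(\<Sum>k\<le>n. w d e n k) = 1" for d e n
  proof -
    have "(\<Sum>k\<le>n. w d e n k) = (\<Sum>k\<le>n. growth \<beta> d k * growth \<beta> e (n - k)) / growth \<beta> (Suc (d + e)) n"
      by (simp add: w_def sum_divide_distrib)
    then show ?thesis using g by (simp add: growth_convolution)
  qed
  have w_fade: "(\<lambda>n. w d e n k) \<longlonglongrightarrow> 0" for d e k
  proof -
    \<comment> \<open>Up to the factor \<open>growth \<beta> d k\<close>, the weight is \<open>growth \<beta> e (n - k)\<close> divided by a larger scale.\<close>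
    define \<delta> where "\<delta> j = (if j = k then growth \<beta> d k else 0)" for j
    have "(\<lambda>n. growth \<beta> e n / growth \<beta> (Suc (d + e)) n) \<longlonglongrightarrow> 0"
      using \<beta> by (intro growth_dominated) auto
    moreover have "(\<lambda>n. (\<Sum>j\<le>n. \<delta> j * growth \<beta> e (n - j)) / growth \<beta> e n) \<longlonglongrightarrow> (\<Sum>n. \<delta> n / \<beta> ^ n * 1)"
      using \<beta> g by (intro convolution_limit_summable summable_finite[of "{k}"]) (auto simp: \<delta>_def)
    ultimately have "(\<lambda>n. (\<Sum>j\<le>n. \<delta> j * growth \<beta> e (n - j)) / growth \<beta> e n
        * (growth \<beta> e n / growth \<beta> (Suc (d + e)) n)) \<longlonglongrightarrow> (\<Sum>n. \<delta> n / \<beta> ^ n * 1) * 0"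
      by (intro tendsto_mult)
    moreover have "(\<Sum>j\<le>n. \<delta> j * growth \<beta> e (n - j)) / growth \<beta> e n
        * (growth \<beta> e n / growth \<beta> (Suc (d + e)) n) = w d e n k" for n
      using g by (simp add: \<delta>_def w_def if_distrib[of "\<lambda>t. t * _"] sum.delta cong: if_cong)
    ultimately show ?thesis by simp
  qed
  define x' where "x' n = x n / growth \<beta> d n" for n
  define y' where "y' n = y n / growth \<beta> e n" for n
  obtain K where K: "\<And>n. \<bar>y' n\<bar> \<le> K"
    using convergent_imp_Bseq[OF convergentI[OF y]] by (auto simp: Bseq_def y'_def)
  have K0: "0 \<le> K" using K[of 0] by linarith
  have x0: "(\<lambda>n. \<bar>x' n - c\<bar>) \<longlonglongrightarrow> 0" and y0: "(\<lambda>n. \<bar>y' n - c'\<bar>) \<longlonglongrightarrow> 0"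
    using x y unfolding x'_def y'_def by (simp_all add: tendsto_rabs_zero_iff LIM_zero_iff)
  have err: "(\<lambda>n. K * (\<Sum>k\<le>n. w d e n k * \<bar>x' k - c\<bar>) + \<bar>c\<bar> * (\<Sum>k\<le>n. w e d n k * \<bar>y' k - c'\<bar>)) \<longlonglongrightarrow> K * 0 + \<bar>c\<bar> * 0"
    by (intro tendsto_intros weighted_average_null w_nonneg w_fade x0 y0) (simp_all add: w_total)
  have "(\<lambda>n. (\<Sum>k\<le>n. x k * y (n - k)) / growth \<beta> (Suc (d + e)) n - c * c') \<longlonglongrightarrow> 0"
  proof (rule Lim_null_comparison)
    show "(\<lambda>n. K * (\<Sum>k\<le>n. w d e n k * \<bar>x' k - c\<bar>) + \<bar>c\<bar> * (\<Sum>k\<le>n. w e d n k * \<bar>y' k - c'\<bar>)) \<longlonglongrightarrow> 0"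
      using err by simp
    have "\<bar>(\<Sum>k\<le>n. x k * y (n - k)) / growth \<beta> (Suc (d + e)) n - c * c'\<bar>
        \<le> K * (\<Sum>k\<le>n. w d e n k * \<bar>x' k - c\<bar>) + \<bar>c\<bar> * (\<Sum>k\<le>n. w e d n k * \<bar>y' k - c'\<bar>)" for n
    proof -
      have "(\<Sum>k\<le>n. x k * y (n - k)) / growth \<beta> (Suc (d + e)) n = (\<Sum>k\<le>n. w d e n k * (x' k * y' (n - k)))"
        unfolding sum_divide_distrib using g by (intro sum.cong refl) (simp add: w_def x'_def y'_def)
      moreover have "c * c' = (\<Sum>k\<le>n. w d e n k * (c * c'))"
        by (simp add: w_total flip: sum_distrib_right)
      ultimately have "(\<Sum>k\<le>n. x k * y (n - k)) / growth \<beta> (Suc (d + e)) n - c * c'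
          = (\<Sum>k\<le>n. w d e n k * (x' k * y' (n - k) - c * c'))"
        by (simp add: sum_subtractf right_diff_distrib)
      also have "\<bar>\<dots>\<bar> \<le> (\<Sum>k\<le>n. w d e n k * (K * \<bar>x' k - c\<bar> + \<bar>c\<bar> * \<bar>y' (n - k) - c'\<bar>))"
      proof (rule order_trans[OF sum_abs sum_mono])
        fix k
        have "\<bar>x' k * y' (n - k) - c * c'\<bar> = \<bar>y' (n - k) * (x' k - c) + c * (y' (n - k) - c')\<bar>"
          by (simp add: algebra_simps)
        also have "\<dots> \<le> \<bar>y' (n - k)\<bar> * \<bar>x' k - c\<bar> + \<bar>c\<bar> * \<bar>y' (n - k) - c'\<bar>"
          by (rule order_trans[OF abs_triangle_ineq]) (simp add: abs_mult)
        also have "\<dots> \<le> K * \<bar>x' k - c\<bar> + \<bar>c\<bar> * \<bar>y' (n - k) - c'\<bar>"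
          using K by (intro add_right_mono mult_right_mono) auto
        finally show "\<bar>w d e n k * (x' k * y' (n - k) - c * c')\<bar>
            \<le> w d e n k * (K * \<bar>x' k - c\<bar> + \<bar>c\<bar> * \<bar>y' (n - k) - c'\<bar>)"
          using w_nonneg[of d e n k] by (simp add: abs_mult mult_left_mono)
      qed
      also have "\<dots> = K * (\<Sum>k\<le>n. w d e n k * \<bar>x' k - c\<bar>)
          + \<bar>c\<bar> * (\<Sum>k\<le>n. w d e n k * \<bar>y' (n - k) - c'\<bar>)"
        by (simp add: algebra_simps sum.distrib sum_distrib_left)
      also have "(\<Sum>k\<le>n. w d e n k * \<bar>y' (n - k) - c'\<bar>) = (\<Sum>k\<le>n. w e d n k * \<bar>y' k - c'\<bar>)"
        by (rule sum.reindex_bij_witness[of _ "\<lambda>k. n - k" "\<lambda>k. n - k"]) (auto simp: w_def add.commute)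
      finally show ?thesis .
    qed
    then show "\<forall>\<^sub>F n in sequentially. norm ((\<Sum>k\<le>n. x k * y (n - k)) / growth \<beta> (Suc (d + e)) n - c * c')
        \<le> K * (\<Sum>k\<le>n. w d e n k * \<bar>x' k - c\<bar>) + \<bar>c\<bar> * (\<Sum>k\<le>n. w e d n k * \<bar>y' k - c'\<bar>)"
      by simp
  qed
  then show ?thesis by (simp add: LIM_zero_iff)
qed

lemma summable_of_smaller_rate:
  assumes "0 < \<mu>" "\<mu> < \<beta>" "(\<lambda>n. y n / growth \<mu> e n) \<longlonglongrightarrow> c"
  shows "summable (\<lambda>n. \<bar>y n\<bar> / \<beta> ^ n)"
proof -
  obtain K where K: "\<And>n. \<bar>y n / growth \<mu> e n\<bar> \<le> K"
    using convergent_imp_Bseq[OF convergentI[OF assms(3)]] by (auto simp: Bseq_def)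
  have "summable (\<lambda>n. K * (real ((e + n) choose e) * (\<mu> / \<beta>) ^ n))"
    using assms by (intro summable_mult summable_binomial_geometric) auto
  moreover have "norm (\<bar>y n\<bar> / \<beta> ^ n) \<le> K * (real ((e + n) choose e) * (\<mu> / \<beta>) ^ n)" for n
  proof -
    have "\<bar>y n\<bar> \<le> K * growth \<mu> e n"
      using K[of n] growth_pos[OF assms(1), of e n] by (simp add: abs_divide divide_le_eq)
    then have "\<bar>y n\<bar> / \<beta> ^ n \<le> K * growth \<mu> e n / \<beta> ^ n"
      using assms by (intro divide_right_mono) auto
    then show ?thesis using assms by (simp add: growth_def power_divide)
  qed
  ultimately show ?thesis by (rule summable_comparison_test'[where N = 0])
qed

text \<open>Factors with different \<open>\<beta>\<close>, or with one of finite support, fall under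
  \<open>convolution_limit_summable\<close>; equal rates under
  \<open>convolution_limit_same_rate\<close>.\<close>

lemma regular_growth_convolution:
  assumes x: "regular_growth x" and y: "regular_growth y"
  shows "regular_growth (\<lambda>n. \<Sum>k\<le>n. x k * y (n - k))"
proof -
  have nonneg: "0 \<le> (\<Sum>k\<le>n. x k * y (n - k))" for n
    using x y by (intro sum_nonneg mult_nonneg_nonneg regular_growth_nonneg)
  have swap: "(\<Sum>k\<le>n. u k * v (n - k)) = (\<Sum>k\<le>n. v k * u (n - k))" for n and u v :: "nat \<Rightarrow> real"
    by (rule sum.reindex_bij_witness[of _ "\<lambda>k. n - k" "\<lambda>k. n - k"]) auto
  have light: "regular_growth (\<lambda>n. \<Sum>k\<le>n. v k * u (n - k))"
    if u: "0 < c" "0 < \<beta>" "(\<lambda>n. u n / growth \<beta> d n) \<longlonglongrightarrow> c" "\<And>n. 0 \<le> u n"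
      and v: "\<And>n. 0 \<le> v n" "summable (\<lambda>n. \<bar>v n\<bar> / \<beta> ^ n)" for u v :: "nat \<Rightarrow> real" and c \<beta> d
  proof (cases "\<forall>n. v n = 0")
    case True
    then show ?thesis by (intro regular_growth_finite[of _ 0]) auto
  next
    case False
    then obtain j where "v j \<noteq> 0" by blast
    then have "0 < v j" using v(1)[of j] by simp
    have "summable (\<lambda>n. v n / \<beta> ^ n * c)" using v by (intro summable_mult2) simp
    then have "0 < (\<Sum>n. v n / \<beta> ^ n * c)"
      using v u \<open>0 < v j\<close> by (subst suminf_pos_iff) (auto intro!: exI[of _ j])
    then show ?thesis
      using convolution_limit_summable[OF u(2,3) v(2)] u v
      by (intro regular_growthI[where \<beta> = \<beta> and d = d]) (auto intro!: sum_nonneg)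
  qed
  show ?thesis
  proof (cases rule: regular_growth_cases[OF x])
    case x': (1 N)
    show ?thesis
    proof (cases rule: regular_growth_cases[OF y])
      case y': (1 N')
      show ?thesis
      proof (rule regular_growth_finite[of _ "N + N'"])
        fix n assume n: "N + N' \<le> n"
        show "(\<Sum>k\<le>n. x k * y (n - k)) = 0"
        proof (intro sum.neutral ballI)
          fix k
          have "N \<le> k \<or> N' \<le> n - k" using n by arith
          then show "x k * y (n - k) = 0" using x' y' by auto
        qed
      qed (rule nonneg)
    next
      case (2 c \<mu> e)
      moreover have "summable (\<lambda>n. \<bar>x n\<bar> / \<mu> ^ n)"
        using x' by (intro summable_finite[of "{..<N}"]) (auto simp: not_less)
      ultimately show ?thesis using x y by (intro light) (auto simp: regular_growth_nonneg)
    qed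
  next
    case x': (2 c \<beta> d)
    show ?thesis
    proof (cases rule: regular_growth_cases[OF y])
      case y': (1 N)
      have "summable (\<lambda>n. \<bar>y n\<bar> / \<beta> ^ n)"
        using y' by (intro summable_finite[of "{..<N}"]) (auto simp: not_less)
      with x' show ?thesis
        using x y by (subst swap) (intro light, auto simp: regular_growth_nonneg)
    next
      case y': (2 c' \<mu> e)
      consider "\<beta> = \<mu>" | "\<beta> < \<mu>" | "\<mu> < \<beta>" by linarith
      then show ?thesis
      proof cases
        case 1
        then show ?thesis
          using convolution_limit_same_rate[OF x'(2,3) y'(3)[folded 1]] nonneg x' y'
          by (intro regular_growthI) auto
      next
        case 2
        then show ?thesis using x' y' x y summable_of_smaller_rate[OF x'(2) 2 x'(3)]
          by (intro light) (auto simp: regular_growth_nonneg)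
      next
        case 3
        then show ?thesis using x' y' x y summable_of_smaller_rate[OF y'(2) 3 y'(3)]
          by (subst swap) (intro light, auto simp: regular_growth_nonneg)
      qed
    qed
  qed
qed

section \<open>A renewal theorem\<close>

text \<open>The number \<open>v n\<close> is an average of earlier values, none of which lies much
  above \<open>a\<close>. If the average is near \<open>a\<close>, every value that enters it with
  positive weight must be near \<open>a\<close> as well; the value one step back has weight \<open>p
  1 > 0\<close>.\<close>

lemma renewal_step_back:
  fixes p v :: "nat \<Rightarrow> real"
  assumes p: "\<And>n. 0 \<le> p n" "p sums 1" "0 < p 1"
    and bound: "\<And>n. \<bar>v n\<bar> \<le> C"
    and renew: "eventually (\<lambda>n. v n = (\<Sum>k\<le>n. p k * v (n - k))) sequentially"
    and upper: "\<And>\<epsilon>. 0 < \<epsilon> \<Longrightarrow> eventually (\<lambda>n. v n < a + \<epsilon>) sequentially"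
    and r: "filterlim r at_top sequentially" "(\<lambda>j. v (r j)) \<longlonglongrightarrow> a"
  shows "(\<lambda>j. v (r j - 1)) \<longlonglongrightarrow> a"
proof -
  \<comment> \<open>The excess over \<open>a\<close> tends to \<open>0\<close>, but \<open>v\<close> may fall below \<open>a\<close> by any amount.\<close>
  define pos where "pos n = max (v n - a) 0" for n
  have pos_bound: "0 \<le> pos n" "v n \<le> a + pos n" "pos n \<le> C + \<bar>a\<bar>" for n
    using bound[of n] by (auto simp: pos_def)
  have "pos \<longlonglongrightarrow> 0"
  proof (rule order_tendstoI)
    fix \<epsilon> :: real assume "0 < \<epsilon>"
    from upper[OF this] show "\<forall>\<^sub>F n in sequentially. pos n < \<epsilon>"
      by eventually_elim (use \<open>0 < \<epsilon>\<close> in \<open>auto simp: pos_def\<close>)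
  next
    fix \<epsilon> :: real assume "\<epsilon> < 0"
    then show "\<forall>\<^sub>F n in sequentially. \<epsilon> < pos n"
      by (intro always_eventually) (simp add: pos_def less_max_iff_disj)
  qed
  moreover have shift: "filterlim (\<lambda>j. r j - k) at_top sequentially" for k
    using filterlim_compose[OF filterlim_minus_const_nat_at_top r(1)] by simp
  ultimately have pos_shift: "(\<lambda>j. pos (r j - k)) \<longlonglongrightarrow> 0" for k
    by (rule filterlim_compose)
  have "(\<lambda>j. \<Sum>k\<le>r j. p k * pos (r j - k)) \<longlonglongrightarrow> (\<Sum>k. p k * 0)"
  proof (rule tannery_sum[where m = r and M = "\<lambda>k. p k * (C + \<bar>a\<bar>)"])
    show "summable (\<lambda>k. p k * (C + \<bar>a\<bar>))" using p(2) by (intro summable_mult2) (rule sums_summable)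
    show "\<bar>p k * pos (r j - k)\<bar> \<le> p k * (C + \<bar>a\<bar>)" for k j
      using p(1) pos_bound by (simp add: abs_mult mult_left_mono)
  qed (intro tendsto_intros pos_shift r)+
  then have excess: "(\<lambda>j. \<Sum>k\<le>r j. p k * pos (r j - k)) \<longlonglongrightarrow> 0" by simp
  have mass: "(\<lambda>j. \<Sum>k\<le>r j. p k) \<longlonglongrightarrow> 1"
    using filterlim_compose[OF p(2)[unfolded sums_def_le] r(1)] .
  have "(\<lambda>j. (v (r j) - a * ((\<Sum>k\<le>r j. p k) - p 1) - (\<Sum>k\<le>r j. p k * pos (r j - k))) / p 1)
      \<longlonglongrightarrow> (a - a * (1 - p 1) - 0) / p 1"
    using p(3) by (intro tendsto_intros r excess mass) auto
  also have "(a - a * (1 - p 1) - 0) / p 1 = a" using p(3) by (simp add: field_simps)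
  finally have lower_lim: "(\<lambda>j. (v (r j) - a * ((\<Sum>k\<le>r j. p k) - p 1) - (\<Sum>k\<le>r j. p k * pos (r j - k))) / p 1)
      \<longlonglongrightarrow> a" .
  have upper_lim: "(\<lambda>j. a + pos (r j - 1)) \<longlonglongrightarrow> a"
    using tendsto_add[OF tendsto_const pos_shift[of 1], of a] by simp
  show ?thesis
  proof (rule tendsto_sandwich[OF _ _ lower_lim upper_lim])
    have "eventually (\<lambda>j. v (r j) = (\<Sum>k\<le>r j. p k * v (r j - k))) sequentially"
      using eventually_compose_filterlim[OF renew r(1)] .
    moreover have "eventually (\<lambda>j. 1 \<le> r j) sequentially"
      using r(1) by (simp add: filterlim_at_top)
    ultimately show "\<forall>\<^sub>F j in sequentially. (v (r j) - a * ((\<Sum>k\<le>r j. p k) - p 1)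
        - (\<Sum>k\<le>r j. p k * pos (r j - k))) / p 1 \<le> v (r j - 1)"
    proof eventually_elim
      case (elim j)
      let ?S = "{..r j} - {1}"
      have split: "sum g {..r j} = g 1 + sum g ?S" for g :: "nat \<Rightarrow> real"
        using elim by (intro sum.remove) auto
      have "v (r j) = p 1 * v (r j - 1) + (\<Sum>k\<in>?S. p k * v (r j - k))"
        using elim split[of "\<lambda>k. p k * v (r j - k)"] by simp
      also have "(\<Sum>k\<in>?S. p k * v (r j - k)) \<le> (\<Sum>k\<in>?S. p k * (a + pos (r j - k)))"
        using p pos_bound by (intro sum_mono mult_left_mono) auto
      also have "\<dots> = a * sum p ?S + (\<Sum>k\<in>?S. p k * pos (r j - k))"
        by (simp add: algebra_simps sum.distrib sum_distrib_left)
      also have "sum p ?S = sum p {..r j} - p 1" using split[of p] by simp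
      also have "(\<Sum>k\<in>?S. p k * pos (r j - k)) \<le> (\<Sum>k\<le>r j. p k * pos (r j - k))"
        using p pos_bound by (intro sum_mono2) auto
      finally show ?case using p(3) by (simp add: divide_le_eq mult.commute)
    qed
    show "\<forall>\<^sub>F j in sequentially. v (r j - 1) \<le> a + pos (r j - 1)"
      using pos_bound by simp
  qed
qed

lemma real_limsup_attained:
  fixes v :: "nat \<Rightarrow> real"
  assumes bound: "\<And>n. \<bar>v n\<bar> \<le> C"
  obtains a r where "strict_mono r" "(\<lambda>j. v (r j)) \<longlonglongrightarrow> a"
    "\<And>\<epsilon>. 0 < \<epsilon> \<Longrightarrow> eventually (\<lambda>n. v n < a + \<epsilon>) sequentially"
proof -
  \<comment> \<open>The limit superior is taken in the extended reals; boundedness makes it finite.\<close>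
  define L where "L = limsup (\<lambda>n. ereal (v n))"
  obtain r where r: "strict_mono r" "((\<lambda>n. ereal (v n)) \<circ> r) \<longlonglongrightarrow> L"
    using limsup_subseq_lim[of "\<lambda>n. ereal (v n)"] unfolding L_def by blast
  have "L \<le> ereal C"
    using r(2) by (rule LIMSEQ_le_const2) (use bound in \<open>auto simp: abs_le_iff\<close>)
  moreover have "ereal (- C) \<le> L"
    using r(2) by (rule LIMSEQ_le_const) (use bound in \<open>auto simp: abs_le_iff minus_le_iff\<close>)
  ultimately obtain a where a: "L = ereal a" by (cases L) auto
  show ?thesis
  proof
    show "strict_mono r" by fact
    show "(\<lambda>j. v (r j)) \<longlonglongrightarrow> a" using r(2) by (simp add: a o_def)
    fix \<epsilon> :: real assume "0 < \<epsilon>"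
    then have "limsup (\<lambda>n. ereal (v n)) < ereal (a + \<epsilon>)" using a by (simp add: L_def)
    from Limsup_lessD[OF this] show "eventually (\<lambda>n. v n < a + \<epsilon>) sequentially" by simp
  qed
qed

text \<open>Iterating \<open>renewal_step_back\<close> along a subsequence that realises the limit
  superior \<open>a\<close>, all values at a fixed distance before the subsequence tend to
  \<open>a\<close>. Passing to the limit in the conserved sum along the subsequence then determines
  \<open>a\<close>.\<close>

lemma renewal_limsup_value:
  fixes p q v :: "nat \<Rightarrow> real"
  assumes p: "\<And>n. 0 \<le> p n" "p sums 1" "0 < p 1"
    and bound: "\<And>n. \<bar>v n\<bar> \<le> C"
    and renew: "eventually (\<lambda>n. v n = (\<Sum>k\<le>n. p k * v (n - k))) sequentially"
    and q: "\<And>n. 0 \<le> q n" "summable q"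
    and conserved: "\<And>n. (\<Sum>k\<le>n. q k * v (n - k)) = e"
  obtains a where "a * suminf q = e" "\<And>\<epsilon>. 0 < \<epsilon> \<Longrightarrow> eventually (\<lambda>n. v n < a + \<epsilon>) sequentially"
proof -
  obtain r a where r: "strict_mono r" "(\<lambda>j. v (r j)) \<longlonglongrightarrow> a"
    and upper: "\<And>\<epsilon>. 0 < \<epsilon> \<Longrightarrow> eventually (\<lambda>n. v n < a + \<epsilon>) sequentially"
    by (rule real_limsup_attained[of v C, OF bound]) (rule that)
  have r_top: "filterlim r at_top sequentially" using r(1) by (rule filterlim_subseq)
  have shifted: "(\<lambda>j. v (r j - m)) \<longlonglongrightarrow> a" for m
  proof (induction m)
    case (Suc m)
    have "filterlim (\<lambda>j. r j - m) at_top sequentially"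
      using filterlim_compose[OF filterlim_minus_const_nat_at_top r_top] by simp
    from renewal_step_back[OF p bound renew upper this Suc] show ?case by simp
  qed (use r in simp)
  have "(\<lambda>j. \<Sum>k\<le>r j. q k * v (r j - k)) \<longlonglongrightarrow> (\<Sum>k. q k * a)"
  proof (rule tannery_sum[where m = r and M = "\<lambda>k. q k * C"])
    show "\<bar>q k * v (r j - k)\<bar> \<le> q k * C" for k j
      using q(1) bound by (simp add: abs_mult mult_left_mono)
  qed (intro tendsto_intros shifted summable_mult2 q r_top)+
  then have "(\<Sum>k. q k * a) = e" by (simp add: conserved LIMSEQ_const_iff)
  then have "a * suminf q = e" using suminf_mult2[OF q(2), of a] by (simp add: mult.commute)
  then show ?thesis using upper by (rule that)
qed

text \<open>The theorem of Erdos, Feller and Pollard, with the aperiodicity condition in the special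
  form \<open>p 1 > 0\<close>. Applied to \<open>u\<close> and to \<open>- u\<close>, the previous
  lemma gives the same value for the limit superior and the limit inferior. In the application
  \<open>q\<close> is the sequence of tails of \<open>p\<close>, and \<open>suminf q\<close> is the
  mean step.\<close>

lemma renewal_theorem:
  fixes p q u :: "nat \<Rightarrow> real"
  assumes p: "\<And>n. 0 \<le> p n" "p sums 1" "0 < p 1"
    and bound: "\<And>n. \<bar>u n\<bar> \<le> C"
    and renew: "eventually (\<lambda>n. u n = (\<Sum>k\<le>n. p k * u (n - k))) sequentially"
    and q: "\<And>n. 0 \<le> q n" "summable q"
    and conserved: "\<And>n. (\<Sum>k\<le>n. q k * u (n - k)) = 1"
  shows "0 < suminf q" "u \<longlonglongrightarrow> 1 / suminf q"
proof -
  obtain a where a: "a * suminf q = 1"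
    and up: "\<And>\<epsilon>. 0 < \<epsilon> \<Longrightarrow> eventually (\<lambda>n. u n < a + \<epsilon>) sequentially"
    by (rule renewal_limsup_value[of p u C q 1, OF p bound renew q conserved]) (rule that)
  obtain b where b: "b * suminf q = - 1"
    and down: "\<And>\<epsilon>. 0 < \<epsilon> \<Longrightarrow> eventually (\<lambda>n. - u n < b + \<epsilon>) sequentially"
  proof (rule renewal_limsup_value[of p "\<lambda>n. - u n" C q "- 1"])
    show "\<forall>\<^sub>F n in sequentially. - u n = (\<Sum>k\<le>n. p k * - u (n - k))"
      using renew by eventually_elim (simp add: sum_negf)
    show "(\<Sum>k\<le>n. q k * - u (n - k)) = - 1" for n using conserved[of n] by (simp add: sum_negf)
  qed (use p bound q in auto)
  show pos: "0 < suminf q" using a suminf_nonneg[OF q(2) q(1)] by (cases "suminf q = 0") auto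
  then have a_eq: "a = 1 / suminf q" using a by (simp add: eq_divide_eq)
  have "(a + b) * suminf q = 0" using a b by (simp add: distrib_right)
  then have b_eq: "b = - a" using pos by simp
  have "u \<longlonglongrightarrow> a"
  proof (rule order_tendstoI)
    fix x assume "a < x"
    then show "\<forall>\<^sub>F n in sequentially. u n < x" using up[of "x - a"] by simp
  next
    fix x assume "x < a"
    then show "\<forall>\<^sub>F n in sequentially. x < u n"
      using down[of "a - x"] b_eq by (auto elim: eventually_mono)
  qed
  then show "u \<longlonglongrightarrow> 1 / suminf q" unfolding a_eq .
qed

section \<open>Geometric series of regular sequences\<close>

text \<open>At the radius of convergence \<open>1 / \<beta>\<close> the power series of a sequence
  with infinite support diverges, since its terms do not tend to \<open>0\<close>. So the value
  \<open>1\<close> is exceeded already strictly inside, at some \<open>r\<close>; the margin up to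
  \<open>s\<close> makes the tails at the root decay geometrically.\<close>

lemma regular_growth_reaches_one:
  assumes f: "regular_growth f" "f 0 = 0" "0 < f 1"
  obtains r s N where "0 < r" "r < s" "summable (\<lambda>n. f n * s ^ n)" "1 \<le> (\<Sum>n<N. f n * r ^ n)"
proof (cases rule: regular_growth_cases[OF f(1)])
  case (1 N)
  \<comment> \<open>A finitely supported series converges everywhere, and its linear term alone reaches \<open>1\<close>.\<close>
  have "(\<Sum>n<2. f n * (1 / f 1) ^ n) = 1" using f by (simp add: numeral_2_eq_2)
  moreover have "summable (\<lambda>n. f n * (1 / f 1 + 1) ^ n)"
    using 1 by (intro summable_finite[of "{..<N}"]) (auto simp: not_less)
  ultimately show ?thesis using f by (intro that[of "1 / f 1" "1 / f 1 + 1" 2]) auto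
next
  case (2 c \<beta> d)
  have nonneg: "0 \<le> f n / \<beta> ^ n" for n using f(1) 2 by (simp add: regular_growth_nonneg)
  have "\<exists>N. 1 < (\<Sum>n<N. f n / \<beta> ^ n)"
  proof (rule ccontr)
    assume "\<not> ?thesis"
    then have "summable (\<lambda>n. f n / \<beta> ^ n)"
      using nonneg by (intro summableI_nonneg_bounded[where x = 1]) (auto simp: not_less)
    then have "(\<lambda>n. f n / \<beta> ^ n) \<longlonglongrightarrow> 0" by (rule summable_LIMSEQ_zero)
    \<comment> \<open>The binomial coefficient in the scale is at least \<open>1\<close>.\<close>
    moreover have "f n / growth \<beta> d n \<le> f n / \<beta> ^ n" for n
    proof -
      have "0 < (d + n) choose d" by simp
      then have "1 \<le> real ((d + n) choose d)" by linarith
      then have "\<beta> ^ n \<le> growth \<beta> d n"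
        unfolding growth_def using 2(2) mult_right_mono[of 1 "real ((d + n) choose d)" "\<beta> ^ n"] by simp
      then show ?thesis
        using 2(2) f(1) growth_pos[OF 2(2)] by (intro divide_left_mono) (auto simp: regular_growth_nonneg)
    qed
    ultimately have "c \<le> 0" using 2(3) by (intro LIMSEQ_le[of _ c _ 0]) auto
    then show False using 2 by simp
  qed
  then obtain N where N: "1 < (\<Sum>n<N. f n * (1 / \<beta>) ^ n)" by (auto simp: power_divide)
  have "((\<lambda>r. \<Sum>n<N. f n * r ^ n) \<longlongrightarrow> (\<Sum>n<N. f n * (1 / \<beta>) ^ n)) (at_left (1 / \<beta>))"
    by (intro tendsto_intros)
  from order_tendstoD(1)[OF this N]
  have "\<forall>\<^sub>F r in at_left (1 / \<beta>). 1 < (\<Sum>n<N. f n * r ^ n) \<and> 0 < r \<and> r < 1 / \<beta>"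
    using eventually_at_left_real[of 0 "1 / \<beta>"] 2 by (auto elim: eventually_elim2)
  then obtain r where r: "1 < (\<Sum>n<N. f n * r ^ n)" "0 < r" "r < 1 / \<beta>"
    by (auto dest!: eventually_happens)
  define s where "s = (r + 1 / \<beta>) / 2"
  have s: "r < s" "s < 1 / \<beta>" using r by (auto simp: s_def)
  then have "\<beta> < 1 / s" using r 2 by (simp add: field_simps)
  from summable_of_smaller_rate[OF 2(2) this 2(3)]
  have "summable (\<lambda>n. f n * s ^ n)"
    using f(1) by (simp add: regular_growth_nonneg power_divide)
  then show ?thesis using that r s by (intro that[of r s N]) auto
qed

lemma regular_growth_characteristic_root:
  assumes f: "regular_growth f" "f 0 = 0" "0 < f 1"
  obtains \<rho> s where "0 < \<rho>" "\<rho> < s" "summable (\<lambda>n. f n * s ^ n)" "(\<lambda>n. f n * \<rho> ^ n) sums 1"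
proof -
  obtain r s N where r: "0 < r" "r < s" and s: "summable (\<lambda>n. f n * s ^ n)"
    and N: "1 \<le> (\<Sum>n<N. f n * r ^ n)"
    using regular_growth_reaches_one[OF f] .
  have summ: "summable (\<lambda>n. f n * x ^ n)" if "0 \<le> x" "x \<le> r" for x
    using s by (rule powser_inside) (use that r in auto)
  have "isCont (\<lambda>x. \<Sum>n. f n * x ^ n) x" if "0 \<le> x \<and> x \<le> r" for x
    using s by (rule isCont_powser) (use that r in auto)
  moreover have "(\<Sum>n. f n * 0 ^ n) \<le> 1" using f by (simp add: powser_zero)
  moreover have "(\<Sum>n<N. f n * r ^ n) \<le> (\<Sum>n. f n * r ^ n)"
    using summ r f(1) by (intro sum_le_suminf) (auto simp: regular_growth_nonneg)
  ultimately obtain \<rho> where \<rho>: "0 \<le> \<rho>" "\<rho> \<le> r" "(\<Sum>n. f n * \<rho> ^ n) = 1"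
    using IVT[of "\<lambda>x. \<Sum>n. f n * x ^ n" 0 1 r] N r by auto
  have "\<rho> \<noteq> 0"
  proof
    assume "\<rho> = 0"
    with \<rho>(3) f(2) show False by (simp add: powser_zero)
  qed
  moreover have "(\<lambda>n. f n * \<rho> ^ n) sums 1" using summable_sums[OF summ[OF \<rho>(1,2)]] \<rho>(3) by simp
  ultimately show ?thesis using that[of \<rho> s] \<rho> r s by auto
qed

text \<open>The tail beyond \<open>n\<close> at \<open>\<rho>\<close> is at most \<open>(\<rho> /
  s)\<^sup>n\<close> times the whole sum at \<open>s\<close>.\<close>

lemma geometric_tails_summable:
  fixes f :: "nat \<Rightarrow> real"
  assumes nonneg: "\<And>n. 0 \<le> f n" and \<rho>: "0 < \<rho>" "\<rho> < s"
    and s: "summable (\<lambda>n. f n * s ^ n)" and total: "(\<lambda>n. f n * \<rho> ^ n) sums 1"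
  shows "summable (\<lambda>n. 1 - (\<Sum>k\<le>n. f k * \<rho> ^ k))"
proof -
  define \<theta> where "\<theta> = \<rho> / s"
  have \<theta>: "0 < \<theta>" "\<theta> < 1" and \<theta>_s: "\<rho> = \<theta> * s" using \<rho> by (auto simp: \<theta>_def)
  define T where "T = (\<Sum>n. f n * s ^ n)"
  have summ: "summable (\<lambda>n. f n * \<rho> ^ n)" using total by (rule sums_summable)
  have tail: "1 - (\<Sum>k\<le>n. f k * \<rho> ^ k) = (\<Sum>k. f (k + Suc n) * \<rho> ^ (k + Suc n))" for n
    using suminf_minus_initial_segment[OF summ, of "Suc n"] sums_unique[OF total]
    by (simp only: lessThan_Suc_atMost)
  have tail_le: "(\<Sum>k. f (k + Suc n) * \<rho> ^ (k + Suc n)) \<le> \<theta> ^ n * T" for n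
  proof -
    have "f (k + Suc n) * \<rho> ^ (k + Suc n) \<le> \<theta> ^ n * (f (k + Suc n) * s ^ (k + Suc n))" for k
    proof -
      have "f (k + Suc n) * \<rho> ^ (k + Suc n) = \<theta> ^ (k + Suc n) * (f (k + Suc n) * s ^ (k + Suc n))"
        by (simp only: \<theta>_s power_mult_distrib mult.left_commute)
      also have "\<dots> \<le> \<theta> ^ n * (f (k + Suc n) * s ^ (k + Suc n))"
        using \<theta> \<rho> nonneg by (intro mult_right_mono power_decreasing) auto
      finally show ?thesis .
    qed
    then have "(\<Sum>k. f (k + Suc n) * \<rho> ^ (k + Suc n)) \<le> (\<Sum>k. \<theta> ^ n * (f (k + Suc n) * s ^ (k + Suc n)))"
      by (rule suminf_le[OF _ summable_ignore_initial_segment[OF summ]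
          summable_mult[OF summable_ignore_initial_segment[OF s]]])
    also have "\<dots> = \<theta> ^ n * (\<Sum>k. f (k + Suc n) * s ^ (k + Suc n))"
      by (rule suminf_mult[OF summable_ignore_initial_segment[OF s]])
    also have "(\<Sum>k. f (k + Suc n) * s ^ (k + Suc n)) \<le> T"
    proof -
      have "0 \<le> (\<Sum>i<Suc n. f i * s ^ i)" using \<rho> nonneg by (intro sum_nonneg) auto
      then show ?thesis unfolding T_def suminf_minus_initial_segment[OF s] by linarith
    qed
    finally show ?thesis using \<theta> by simp
  qed
  have "summable (\<lambda>n. \<theta> ^ n * T)" using \<theta> by (intro summable_mult2 summable_geometric) auto
  have "0 \<le> (\<Sum>k. f (k + Suc n) * \<rho> ^ (k + Suc n))" for n
    using \<rho> nonneg by (intro suminf_nonneg summable_ignore_initial_segment[OF summ]) auto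
  then have "norm (1 - (\<Sum>k\<le>n. f k * \<rho> ^ k)) \<le> \<theta> ^ n * T" for n
    unfolding tail using tail_le[of n] by simp
  with \<open>summable (\<lambda>n. \<theta> ^ n * T)\<close> show ?thesis
    by (rule summable_comparison_test'[where N = 0])
qed

text \<open>Multiplying coefficients by \<open>\<rho>\<^sup>n\<close>, where \<open>\<rho>\<close>
  is the root of \<open>f(\<rho>) = 1\<close>, turns \<open>y = 1 + f y\<close> into a renewal
  equation, whose solution has a positive limit. So \<open>y\<close> grows like \<open>(1 /
  \<rho>)\<^sup>n\<close>, without a polynomial factor.\<close>

lemma regular_growth_geometric_inverse:
  fixes f :: "real fps"
  assumes f: "regular_growth (fps_nth f)" "f $ 0 = 0" "0 < f $ 1"
  shows "regular_growth (fps_nth (inverse (1 - f)))"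
proof -
  define y where "y = inverse (1 - f)"
  have nn: "0 \<le> f $ n" for n using f(1) by (rule regular_growth_nonneg)
  have "(1 - f) * y = 1" unfolding y_def using f(2) by (intro inverse_mult_eq_1') simp
  then have y_eq: "y = 1 + f * y" by (simp add: algebra_simps)
  have y_nonneg: "0 \<le> y $ n" for n
  proof (induction n rule: less_induct)
    case (less n)
    have "0 \<le> f $ i * y $ (n - i)" if "i \<le> n" for i
    proof (cases "i = 0")
      case False
      then show ?thesis using that less[of "n - i"] nn[of i] by simp
    qed (simp add: f)
    then have "0 \<le> (\<Sum>i=0..n. f $ i * y $ (n - i))" by (intro sum_nonneg) simp
    moreover have "y $ n = (1 :: real fps) $ n + (\<Sum>i=0..n. f $ i * y $ (n - i))"
      by (subst y_eq) (simp only: fps_add_nth fps_mult_nth)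
    moreover have "0 \<le> (1 :: real fps) $ n" by simp
    ultimately show ?case by linarith
  qed
  obtain \<rho> s where \<rho>: "0 < \<rho>" "\<rho> < s" and s: "summable (\<lambda>n. f $ n * s ^ n)"
    and total: "(\<lambda>n. f $ n * \<rho> ^ n) sums 1"
    using regular_growth_characteristic_root[of "fps_nth f"] f by auto
  define p where "p n = f $ n * \<rho> ^ n" for n
  define u where "u n = y $ n * \<rho> ^ n" for n
  define q where "q n = 1 - (\<Sum>k\<le>n. p k)" for n
  have p_nonneg: "0 \<le> p n" for n using nn \<rho> by (simp add: p_def)
  have renew: "u n = (if n = 0 then 1 else 0) + (\<Sum>k\<le>n. p k * u (n - k))" for n
  proof -
    have "u n = (1 :: real fps) $ n * \<rho> ^ n + (\<Sum>k\<le>n. f $ k * y $ (n - k)) * \<rho> ^ n"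
      unfolding u_def by (subst y_eq) (simp only: fps_add_nth fps_mult_nth atLeast0AtMost distrib_right)
    also have "(\<Sum>k\<le>n. f $ k * y $ (n - k)) * \<rho> ^ n = (\<Sum>k\<le>n. p k * u (n - k))"
      unfolding sum_distrib_right
    proof (intro sum.cong refl)
      fix k assume "k \<in> {..n}"
      then have "\<rho> ^ n = \<rho> ^ k * \<rho> ^ (n - k)" by (simp flip: power_add)
      then show "f $ k * y $ (n - k) * \<rho> ^ n = p k * u (n - k)" by (simp add: p_def u_def)
    qed
    finally show ?thesis by (cases "n = 0") simp_all
  qed
  have conserved: "(\<Sum>k\<le>n. q k * u (n - k)) = 1" for n
  proof -
    \<comment> \<open>The tails \<open>q\<close> have generating function \<open>(1 - P) / (1 - X)\<close>, which cancels \<open>U = 1 / (1 - P)\<close>.\<close>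
    define P U G :: "real fps" where "P = Abs_fps p" and "U = Abs_fps u" and "G = Abs_fps (\<lambda>_. 1)"
    have "U = 1 + P * U"
    proof (rule fps_ext)
      fix n
      show "U $ n = (1 + P * U) $ n"
        unfolding U_def fps_nth_Abs_fps
        by (subst renew) (simp add: P_def fps_mult_nth atLeast0AtMost)
    qed
    then have "(1 - P) * U = 1" by (simp add: algebra_simps)
    moreover have "(1 - P) * G = Abs_fps q"
    proof (rule fps_ext)
      fix n
      have "((1 - P) * G) $ n = (\<Sum>k\<le>n. (1 :: real fps) $ k) - (\<Sum>k\<le>n. p k)"
        by (simp add: fps_mult_nth atLeast0AtMost P_def G_def sum_subtractf)
      also have "(\<Sum>k\<le>n. (1 :: real fps) $ k) = 1" by (simp add: sum.delta)
      finally show "((1 - P) * G) $ n = Abs_fps q $ n" by (simp add: q_def)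
    qed
    moreover have "(1 - P) * G * U = (1 - P) * U * G" by (simp only: mult_ac)
    ultimately have "Abs_fps q * U = G" by (simp only: mult_1_left)
    then have "(Abs_fps q * U) $ n = 1" by (simp add: G_def)
    then show ?thesis by (simp add: fps_mult_nth atLeast0AtMost U_def)
  qed
  have q_nonneg: "0 \<le> q n" for n
    using sum_le_suminf[OF sums_summable[OF total], of "{..n}"] sums_unique[OF total] p_nonneg
    by (simp add: q_def p_def)
  have u_nonneg: "0 \<le> u n" for n using y_nonneg \<rho> by (simp add: u_def)
  have "u n \<le> 1" for n
  proof -
    have "q 0 * u (n - 0) \<le> (\<Sum>k\<le>n. q k * u (n - k))"
      using q_nonneg u_nonneg by (intro member_le_sum[of 0 "{..n}" "\<lambda>k. q k * u (n - k)"]) auto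
    moreover have "q 0 = 1" using f(2) by (simp add: q_def p_def)
    ultimately show ?thesis using conserved[of n] by simp
  qed
  then have bound: "\<bar>u n\<bar> \<le> 1" for n using u_nonneg[of n] by simp
  have ev: "eventually (\<lambda>n. u n = (\<Sum>k\<le>n. p k * u (n - k))) sequentially"
    using eventually_gt_at_top[of 0]
  proof eventually_elim
    case (elim n)
    then show ?case by (subst renew) simp
  qed
  have "p sums 1" "0 < p 1" "summable q"
    using total f(3) \<rho> geometric_tails_summable[OF nn \<rho> s total]
    by (auto simp: p_def[abs_def] q_def[abs_def])
  note lim = renewal_theorem[OF p_nonneg this(1,2) bound ev q_nonneg this(3) conserved]
  show ?thesis
    unfolding y_def[symmetric]
  proof (rule regular_growthI)
    show "0 < 1 / suminf q" "0 < 1 / \<rho>" using lim \<rho> by auto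
    show "(\<lambda>n. y $ n / growth (1 / \<rho>) 0 n) \<longlonglongrightarrow> 1 / suminf q"
      using lim(2) by (simp add: growth_def u_def[abs_def] power_divide)
  qed (rule y_nonneg)
qed

section \<open>Entries of powers of nonnegative matrices\<close>

text \<open>The generating function, by length, of the weighted walks of positive length from
  \<open>i\<close> to \<open>j\<close> whose interior vertices all belong to \<open>ks\<close>. In
  the recursive step a walk that visits \<open>k\<close> is cut at its first and last visit; the
  part in between is a sequence of closed walks at \<open>k\<close>, counted by a geometric
  series.\<close>

fun walks :: "('a \<Rightarrow> 'a \<Rightarrow> real) \<Rightarrow> 'a list \<Rightarrow> 'a \<Rightarrow> 'a \<Rightarrow> real fps" where
  "walks A [] i j = fps_const (A i j) * fps_X"
| "walks A (k # ks) i j =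
     walks A ks i j + walks A ks i k * inverse (1 - walks A ks k k) * walks A ks k j"

lemma walks_nth_0 [simp]: "walks A ks i j $ 0 = 0"
  by (induction ks arbitrary: i j) auto

text \<open>A walk of length one has no interior vertices.\<close>

lemma walks_nth_1: "walks A ks i j $ 1 = A i j"
  by (induction ks arbitrary: i j) auto

text \<open>Together with \<open>walks_nth_1\<close> this shows that, under the loop property, a
  series of closed walks is either zero or has a positive linear coefficient, as the renewal
  argument requires.\<close>

lemma walks_eq_0:
  assumes "(i, j) \<notin> {(i, j). A i j \<noteq> 0}\<^sup>+"
  shows "walks A ks i j = 0"
  using assms
proof (induction ks arbitrary: i j)
  case (Cons k ks)
  then have "(i, k) \<notin> {(i, j). A i j \<noteq> 0}\<^sup>+ \<or> (k, j) \<notin> {(i, j). A i j \<noteq> 0}\<^sup>+"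
    by (meson trancl_trans)
  then show ?case using Cons by auto
qed auto

lemma regular_growth_mult:
  "regular_growth (fps_nth f) \<Longrightarrow> regular_growth (fps_nth g) \<Longrightarrow> regular_growth (fps_nth (f * g))"
  using regular_growth_convolution[of "fps_nth f" "fps_nth g"]
  by (simp add: fps_mult_nth[abs_def] atLeast0AtMost)

lemma regular_growth_walks:
  assumes nonneg: "\<And>i j. 0 \<le> A i j"
    and loops: "\<And>k. (k, k) \<in> {(i, j). A i j \<noteq> 0}\<^sup>+ \<Longrightarrow> A k k \<noteq> 0"
  shows "regular_growth (fps_nth (walks A ks i j))"
proof (induction ks arbitrary: i j)
  case Nil
  show ?case using nonneg by (intro regular_growth_finite[of _ 2]) (auto simp: fps_X_nth)
next
  case (Cons k ks)
  have "regular_growth (fps_nth (inverse (1 - walks A ks k k)))"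
  proof (cases "A k k = 0")
    case True
    then have "walks A ks k k = 0" using loops by (intro walks_eq_0) blast
    then show ?thesis by (intro regular_growth_finite[of _ 1]) auto
  next
    case False
    then have "0 < walks A ks k k $ 1" using nonneg[of k k] by (simp only: walks_nth_1)
    then show ?thesis using Cons by (intro regular_growth_geometric_inverse) auto
  qed
  with Cons show ?case
    by (simp add: fps_add_nth[abs_def] regular_growth_add regular_growth_mult)
qed

text \<open>Gaussian elimination in the linear system for \<open>G\<close>. When the letters of
  \<open>ks\<close> have been eliminated, the coefficients of the remaining system are the series
  \<open>walks A ks\<close>; the step from \<open>ks\<close> to \<open>k # ks\<close> solves the
  \<open>k\<close>-th equation for \<open>G k\<close> and substitutes the result into the
  others.\<close>

lemma walks_elimination:
  fixes A :: "'a::finite \<Rightarrow> 'a \<Rightarrow> real"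
  assumes G: "\<And>i. G i = (if i = j then 1 else 0) + (\<Sum>k\<in>UNIV. fps_const (A i k) * fps_X * G k)"
    and "distinct ks"
  shows "G i = (if i = j then 1 else 0) + (if j \<in> set ks then walks A ks i j else 0)
           + (\<Sum>l\<in>- set ks. walks A ks i l * G l)"
  using assms(2)
proof (induction ks arbitrary: i)
  case Nil
  show ?case by (simp add: G[of i])
next
  case (Cons k ks)
  define W where "W = walks A ks"
  define S where "S = inverse (1 - W k k)"
  define R where "R i = (if j \<in> set ks then W i j else 0) + (\<Sum>l\<in>- set (k # ks). W i l * G l)" for i
  have SW: "S * (1 - W k k) = 1"
    unfolding S_def by (rule inverse_mult_eq_1) (simp add: W_def)
  then have S: "S = 1 + S * W k k" by (simp add: algebra_simps)
  have split: "G i = (if i = j then 1 else 0) + R i + W i k * G k" for i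
  proof -
    have "- set (k # ks) = - set ks - {k}" by auto
    then have "(\<Sum>l\<in>- set ks. W i l * G l) = W i k * G k + (\<Sum>l\<in>- set (k # ks). W i l * G l)"
      using Cons.prems by (simp only:) (rule sum.remove, auto)
    moreover have "G i = (if i = j then 1 else 0) + (if j \<in> set ks then W i j else 0)
        + (\<Sum>l\<in>- set ks. W i l * G l)"
      unfolding W_def using Cons.prems by (intro Cons.IH) simp
    ultimately show ?thesis unfolding R_def by (simp only: add_ac)
  qed
  have "G k = S * ((1 - W k k) * G k)" using SW by (simp flip: mult.assoc)
  also have "(1 - W k k) * G k = (if k = j then 1 else 0) + R k"
    using split[of k] by (simp add: algebra_simps)
  finally have Gk: "G k = S * ((if k = j then 1 else 0) + R k)" .
  have "G i = (if i = j then 1 else 0) + R i + W i k * (S * ((if k = j then 1 else 0) + R k))"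
    using split[of i] Gk by simp
  also have "\<dots> = (if i = j then 1 else 0)
      + (if j \<in> set (k # ks) then W i j + W i k * S * W k j else 0)
      + (\<Sum>l\<in>- set (k # ks). (W i l + W i k * S * W k l) * G l)"
  proof -
    have tail: "(\<Sum>l\<in>- set (k # ks). (W i l + W i k * S * W k l) * G l)
        = (\<Sum>l\<in>- set (k # ks). W i l * G l) + W i k * S * (\<Sum>l\<in>- set (k # ks). W k l * G l)"
      by (simp add: distrib_right sum.distrib sum_distrib_left mult.assoc)
    have "W i k * S = W i k * (1 + S * W k k)" using S by (rule arg_cong)
    also have "\<dots> = W i k + W i k * S * W k k" by (simp only: distrib_left mult.assoc mult_1_right)
    finally have loop: "W i k + W i k * S * W k k = W i k * S" by (rule sym)
    show ?thesis
    proof (cases "k = j")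
      case True
      have "j \<notin> set ks" "j \<in> set (k # ks)" using Cons.prems True by auto
      then show ?thesis unfolding tail R_def unfolding True[symmetric] loop
        by (simp add: algebra_simps)
    next
      case False
      then have "j \<in> set (k # ks) \<longleftrightarrow> j \<in> set ks" by auto
      then show ?thesis unfolding tail R_def using False
        by (cases "j \<in> set ks")
          (simp_all only: if_True if_False distrib_left mult.assoc add_0_left add_ac)
    qed
  qed
  finally show ?case by (simp add: W_def S_def)
qed

text \<open>Here \<open>x t i\<close> is the entry in row \<open>i\<close> and column
  \<open>j\<close> of the \<open>t\<close>-th power of \<open>A\<close>, given by its recursion.
  After elimination of all vertices its generating function is explicit.\<close>

lemma regular_growth_matrix_powers:
  fixes A :: "'a::finite \<Rightarrow> 'a \<Rightarrow> real" and x :: "nat \<Rightarrow> 'a \<Rightarrow> real"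
  assumes nonneg: "\<And>i k. 0 \<le> A i k"
    and loops: "\<And>k. (k, k) \<in> {(i, j). A i j \<noteq> 0}\<^sup>+ \<Longrightarrow> A k k \<noteq> 0"
    and start: "\<And>i. x 0 i = (if i = j then 1 else 0)"
    and step: "\<And>t i. x (Suc t) i = (\<Sum>k\<in>UNIV. A i k * x t k)"
  shows "regular_growth (\<lambda>t. x t i)"
proof -
  define G where "G i = Abs_fps (\<lambda>t. x t i)" for i
  have G: "G i = (if i = j then 1 else 0) + (\<Sum>k\<in>UNIV. fps_const (A i k) * fps_X * G k)" for i
  proof (rule fps_ext)
    fix n
    show "G i $ n = ((if i = j then 1 else 0) + (\<Sum>k\<in>UNIV. fps_const (A i k) * fps_X * G k)) $ n"
      by (cases n) (simp_all add: G_def start step fps_sum_nth mult.assoc)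
  qed
  obtain ks where ks: "distinct ks" "set ks = (UNIV :: 'a set)"
    using finite_distinct_list[of "UNIV :: 'a set"] by auto
  have "G i = (if i = j then 1 else 0) + walks A ks i j"
    using walks_elimination[OF G ks(1), of i] ks(2) by simp
  then have "x t i = (if i = j \<and> t = 0 then 1 else 0) + walks A ks i j $ t" for t
    by (auto simp: G_def fps_eq_iff)
  moreover have "regular_growth (\<lambda>t. (if i = j \<and> t = 0 then 1 else 0) + walks A ks i j $ t)"
    by (intro regular_growth_add regular_growth_walks nonneg loops)
      (auto intro!: regular_growth_finite[of _ 1])
  ultimately show ?thesis by simp
qed

section \<open>Powers of substitutions\<close>

lemma subst_ext_append [simp]: "subst_ext \<zeta> (u @ v) = subst_ext \<zeta> u @ subst_ext \<zeta> v"
  by (simp add: subst_ext_def)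

lemma subst_ext_Nil [simp]: "subst_ext \<zeta> [] = []"
  by (simp add: subst_ext_def)

lemma subst_ext_Cons: "subst_ext \<zeta> (a # u) = \<zeta> a @ subst_ext \<zeta> u"
  by (simp add: subst_ext_def)

lemma funpow_subst_ext: "subst_ext \<zeta> ^^ k = subst_ext (subst_power \<zeta> k)"
proof
  have append: "(subst_ext \<zeta> ^^ k) (u @ v) = (subst_ext \<zeta> ^^ k) u @ (subst_ext \<zeta> ^^ k) v" for u v
    by (induction k) auto
  have empty: "(subst_ext \<zeta> ^^ k) [] = []" by (induction k) auto
  show "(subst_ext \<zeta> ^^ k) u = subst_ext (subst_power \<zeta> k) u" for u
  proof (induction u)
    case (Cons a u)
    then show ?case using append[of "[a]" u] by (simp add: subst_ext_Cons subst_power_def)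
  qed (simp add: empty)
qed

lemma subst_power_add: "subst_power \<zeta> (s + t) a = subst_ext (subst_power \<zeta> s) (subst_power \<zeta> t a)"
  by (simp add: subst_power_def[of \<zeta> "s + t"] subst_power_def[of \<zeta> t] funpow_add flip: funpow_subst_ext)

lemma subst_power_power: "subst_power (subst_power \<zeta> s) t = subst_power \<zeta> (s * t)"
  by (rule ext) (simp add: subst_power_def[of "subst_power \<zeta> s"] subst_power_def[of \<zeta> "s * t"]
      funpow_mult mult.commute flip: funpow_subst_ext)

lemma subst_power_0 [simp]: "subst_power \<zeta> 0 a = [a]"
  by (simp add: subst_power_def)

lemma subst_power_1 [simp]: "subst_power \<zeta> (Suc 0) a = \<zeta> a"
  by (simp add: subst_power_def subst_ext_def)

lemma length_subst_ext_ge: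
  "(\<And>a. c \<le> length (\<eta> a)) \<Longrightarrow> c * length u \<le> length (subst_ext \<eta> u)"
  by (induction u) (auto simp: subst_ext_Cons intro: add_mono)

lemma sum_list_letters:
  fixes f :: "'a::finite \<Rightarrow> nat"
  shows "sum_list (map f u) = (\<Sum>c\<in>UNIV. count_list u c * f c)"
  by (rule sum_list_map_eq_sum_count2) auto

lemma count_list_subst_ext:
  fixes u :: "'a::finite list"
  shows "count_list (subst_ext \<eta> u) b = (\<Sum>c\<in>UNIV. count_list u c * count_list (\<eta> c) b)"
proof -
  have "count_list (subst_ext \<eta> u) b = sum_list (map (\<lambda>c. count_list (\<eta> c) b) u)"
    by (induction u) (auto simp: subst_ext_Cons)
  then show ?thesis by (simp only: sum_list_letters)
qed

lemma length_subst_ext: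
  fixes u :: "'a::finite list"
  shows "length (subst_ext \<eta> u) = (\<Sum>c\<in>UNIV. count_list u c * length (\<eta> c))"
proof -
  have "length (subst_ext \<eta> u) = sum_list (map (\<lambda>c. length (\<eta> c)) u)"
    by (induction u) (auto simp: subst_ext_Cons)
  then show ?thesis by (simp only: sum_list_letters)
qed

lemma length_eq_sum_count: "length (u :: 'a::finite list) = (\<Sum>c\<in>UNIV. count_list u c)"
  using sum_count_set[of u UNIV] by simp

text \<open>A letter with empty image would have empty images under all later powers too.\<close>

lemma expanding_nonerasing:
  assumes "expanding \<xi>"
  shows "0 < length (subst_power \<xi> t a)"
proof -
  obtain k where k: "1 \<le> k" "\<And>a. 2 \<le> length (subst_power \<xi> k a)"
    using assms unfolding expanding_def by blast
  have "\<xi> b \<noteq> []" for b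
  proof
    assume "\<xi> b = []"
    moreover obtain m where "k = m + 1" using k(1) by (cases k) auto
    ultimately have "subst_power \<xi> k b = []" by (simp only: subst_power_add) simp
    then show False using k(2)[of b] by simp
  qed
  then have "1 \<le> length (\<xi> b)" for b by (simp add: Suc_le_eq)
  then have step: "length u \<le> length (subst_ext \<xi> u)" for u
    using length_subst_ext_ge[of 1 \<xi> u] by simp
  have "1 \<le> length (subst_power \<xi> t a)"
  proof (induction t)
    case (Suc t)
    have "subst_power \<xi> (Suc t) a = subst_ext \<xi> (subst_power \<xi> t a)"
      by (simp add: subst_power_def)
    then show ?case using order_trans[OF Suc step] by simp
  qed simp
  then show ?thesis by linarith
qed

lemma expanding_lengths_unbounded:
  assumes "expanding \<xi>" "1 \<le> s"
  shows "\<exists>t. \<forall>a. K \<le> length (subst_power (subst_power \<xi> s) t a)"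
proof -
  obtain k where k: "1 \<le> k" "\<And>a. 2 \<le> length (subst_power \<xi> k a)"
    using assms unfolding expanding_def by blast
  have "2 ^ m \<le> length (subst_power \<xi> (k * m) a)" for m a
  proof (induction m)
    case (Suc m)
    have "2 ^ Suc m \<le> 2 * length (subst_power \<xi> (k * m) a)" using Suc by simp
    also have "\<dots> \<le> length (subst_power \<xi> (k + k * m) a)"
      unfolding subst_power_add using k by (intro length_subst_ext_ge)
    finally show ?case by simp
  qed simp
  then have "2 ^ (s * K) \<le> length (subst_power (subst_power \<xi> s) (k * K) a)" for a
    unfolding subst_power_power mult.left_commute[of s k K] .
  moreover have "K \<le> 2 ^ (s * K)"
  proof -
    have "K \<le> s * K" using assms(2) by simp
    also have "\<dots> < 2 ^ (s * K)" by (rule less_exp)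
    finally show ?thesis by simp
  qed
  ultimately have "K \<le> length (subst_power (subst_power \<xi> s) (k * K) a)" for a
    by (rule order_trans[rotated])
  then show ?thesis by (intro exI[of _ "k * K"] allI)
qed

lemma set_subst_power_mult:
  "k \<in> set (subst_power \<xi> l k) \<Longrightarrow> k \<in> set (subst_power \<xi> (l * m) k)"
proof (induction m)
  case (Suc m)
  then have "k \<in> set (subst_power \<xi> (l * m + l) k)"
    unfolding subst_power_add subst_ext_def by auto
  then show ?case by (simp add: add.commute)
qed simp

section \<open>Letter frequencies\<close>

text \<open>If \<open>k\<close> occurs in \<open>\<xi>\<^sup>l(k)\<close>, it occurs in
  \<open>\<xi>\<^sup>m(k)\<close> for every multiple \<open>m\<close> of \<open>l\<close>. So the
  product over all letters of one suitable exponent each will do.\<close>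

lemma exists_loop_power:
  fixes \<xi> :: "('a::finite) substitution"
  obtains s where "1 \<le> s"
    "\<And>k l. 1 \<le> l \<Longrightarrow> k \<in> set (subst_power \<xi> l k) \<Longrightarrow> k \<in> set (subst_power \<xi> s k)"
proof -
  have "\<exists>L\<ge>1. \<forall>l\<ge>1. k \<in> set (subst_power \<xi> l k) \<longrightarrow> k \<in> set (subst_power \<xi> L k)" for k
  proof (cases "\<exists>l\<ge>1. k \<in> set (subst_power \<xi> l k)")
    case True
    then show ?thesis by blast
  next
    case False
    then show ?thesis by (intro exI[of _ 1]) auto
  qed
  then obtain L where L_pos: "\<And>k. 1 \<le> L k"
    and L: "\<And>k l. 1 \<le> l \<Longrightarrow> k \<in> set (subst_power \<xi> l k) \<Longrightarrow> k \<in> set (subst_power \<xi> (L k) k)"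
    by metis
  show ?thesis
  proof
    show "1 \<le> (\<Prod>k\<in>UNIV. L k)" using L_pos by (intro prod_ge_1)
    fix k l assume *: "1 \<le> (l::nat)" "k \<in> set (subst_power \<xi> l k)"
    have "L k dvd (\<Prod>k\<in>UNIV. L k)" by (rule dvd_prodI) auto
    then obtain m where m: "(\<Prod>k\<in>UNIV. L k) = L k * m" by (rule dvdE)
    show "k \<in> set (subst_power \<xi> (\<Prod>k\<in>UNIV. L k) k)"
      unfolding m using L[OF *] by (rule set_subst_power_mult)
  qed
qed

lemma trancl_letters:
  assumes "(i, j) \<in> {(i, j). real (count_list (\<zeta> i) j) \<noteq> 0}\<^sup>+"
  shows "\<exists>l\<ge>1. j \<in> set (subst_power \<zeta> l i)"
  using assms
proof (induction rule: trancl_induct)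
  case (base j)
  then show ?case by (intro exI[of _ 1]) (auto simp: count_list_0_iff)
next
  case (step j m)
  then obtain l where l: "1 \<le> l" "j \<in> set (subst_power \<zeta> l i)" by blast
  have "m \<in> set (\<zeta> j)" using step by (simp add: count_list_0_iff)
  then have "m \<in> set (subst_power \<zeta> (1 + l) i)"
    unfolding subst_power_add using l by (auto simp: subst_ext_def)
  then show ?case by (intro exI[of _ "1 + l"]) simp
qed

text \<open>Letter counts are entries of powers of the incidence matrix, and lengths are sums of
  letter counts.\<close>

lemma letter_frequencies_converge:
  fixes \<zeta> :: "('a::finite) substitution"
  assumes loops: "\<And>k l. 1 \<le> l \<Longrightarrow> k \<in> set (subst_power \<zeta> l k) \<Longrightarrow> k \<in> set (\<zeta> k)"
    and nonempty: "\<And>t a. 0 < length (subst_power \<zeta> t a)"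
  shows "convergent (\<lambda>t. real (count_list (subst_power \<zeta> t a) b) / real (length (subst_power \<zeta> t a)))"
proof (rule regular_growth_ratio_convergent)
  have counts: "regular_growth (\<lambda>t. real (count_list (subst_power \<zeta> t a) b))" for b
  proof (rule regular_growth_matrix_powers[where A = "\<lambda>i k. real (count_list (\<zeta> i) k)"
        and x = "\<lambda>t i. real (count_list (subst_power \<zeta> t i) b)"])
    fix k assume "(k, k) \<in> {(i, j). real (count_list (\<zeta> i) j) \<noteq> 0}\<^sup>+"
    from trancl_letters[OF this] have "k \<in> set (\<zeta> k)" using loops by blast
    then show "real (count_list (\<zeta> k) k) \<noteq> 0" by (simp add: count_list_0_iff)
  next
    fix t i
    have "subst_power \<zeta> (Suc t) i = subst_ext (subst_power \<zeta> t) (\<zeta> i)"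
      using subst_power_add[of \<zeta> t 1 i] by simp
    then show "real (count_list (subst_power \<zeta> (Suc t) i) b)
        = (\<Sum>k\<in>UNIV. real (count_list (\<zeta> i) k) * real (count_list (subst_power \<zeta> t k) b))"
      by (simp add: count_list_subst_ext)
  qed auto
  then show "regular_growth (\<lambda>t. real (count_list (subst_power \<zeta> t a) b))" .
  from regular_growth_sum[OF finite counts]
  show "regular_growth (\<lambda>t. real (length (subst_power \<zeta> t a)))"
    by (simp add: length_eq_sum_count)
qed (use nonempty count_le_length in auto)

section \<open>Frequencies of factors\<close>

text \<open>A factorization is determined by the length of its prefix.\<close>

lemma occurrences_positions:
  "occurrences w u = card {i. i + length w \<le> length u \<and> take (length w) (drop i u) = w}"
  unfolding occurrences_def
proof (rule bij_betw_same_card[of "\<lambda>(p, q). length p"], rule bij_betwI[where g = "\<lambda>i. (take i u, drop (i + length w) u)"])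
  show "(\<lambda>i. (take i u, drop (i + length w) u))
      \<in> {i. i + length w \<le> length u \<and> take (length w) (drop i u) = w} \<rightarrow> {(p, q). u = p @ w @ q}"
  proof (clarsimp)
    fix i assume "take (length w) (drop i u) = w"
    then have "w @ drop (i + length w) u = drop i u"
      using append_take_drop_id[of "length w" "drop i u"] by (simp add: add.commute)
    then show "u = take i u @ w @ drop (i + length w) u" by simp
  qed
qed auto

lemma occurrences_Nil: "w \<noteq> [] \<Longrightarrow> occurrences w [] = 0"
  by (simp add: occurrences_def)

text \<open>An occurrence that lies neither in \<open>u\<close> nor in \<open>v\<close> starts at
  one of the last \<open>\<bar>w\<bar>\<close> positions of \<open>u\<close>. As \<open>w\<close> is
  non-empty, no occurrence is counted for both words.\<close>

lemma occurrences_append: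
  assumes "w \<noteq> []"
  shows "occurrences w u + occurrences w v \<le> occurrences w (u @ v)"
    and "occurrences w (u @ v) \<le> occurrences w u + occurrences w v + length w"
proof -
  define P where "P x = {i. i + length w \<le> length x \<and> take (length w) (drop i x) = w}" for x
  have fin: "finite (P x)" for x by (rule finite_subset[of _ "{..length x}"]) (auto simp: P_def)
  define I where "I = P u \<union> (\<lambda>i. length u + i) ` P v"
  have "0 < length w" using assms by simp
  then have "P u \<inter> (\<lambda>i. length u + i) ` P v = {}" by (auto simp: P_def)
  then have card_I: "card I = occurrences w u + occurrences w v"
    unfolding I_def occurrences_positions P_def[symmetric]
    using fin by (simp add: card_Un_disjoint card_image)
  have fin_I: "finite I" using fin by (simp add: I_def)
  have sub: "I \<subseteq> P (u @ v)" by (auto simp: I_def P_def)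
  \<comment> \<open>The interval holds the starting positions of the occurrences that straddle the boundary.\<close>
  have sup: "P (u @ v) \<subseteq> I \<union> {length u - length w..<length u}"
  proof
    fix i assume i: "i \<in> P (u @ v)"
    consider "i + length w \<le> length u" | "length u \<le> i" | "length u < i + length w" "i < length u"
      by linarith
    then show "i \<in> I \<union> {length u - length w..<length u}"
    proof cases
      case 1
      then show ?thesis using i by (auto simp: I_def P_def)
    next
      case 2
      then have "i - length u \<in> P v" using i by (auto simp: P_def)
      then have "length u + (i - length u) \<in> I" unfolding I_def by blast
      then show ?thesis using 2 by simp
    next
      case 3
      then show ?thesis by auto
    qed
  qed
  show "occurrences w u + occurrences w v \<le> occurrences w (u @ v)"
    using card_mono[OF fin sub] unfolding card_I occurrences_positions P_def .
  have "card (P (u @ v)) \<le> card I + card {length u - length w..<length u}"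
    using card_mono[OF _ sup] fin_I by (intro order_trans[OF _ card_Un_le]) simp
  also have "\<dots> \<le> card I + length w" by simp
  finally show "occurrences w (u @ v) \<le> occurrences w u + occurrences w v + length w"
    unfolding card_I occurrences_positions P_def .
qed

lemma occurrences_subst_ext:
  fixes u :: "'a::finite list"
  assumes "w \<noteq> []"
  shows "(\<Sum>c\<in>UNIV. count_list u c * occurrences w (\<eta> c)) \<le> occurrences w (subst_ext \<eta> u)"
    and "occurrences w (subst_ext \<eta> u)
      \<le> (\<Sum>c\<in>UNIV. count_list u c * occurrences w (\<eta> c)) + length u * length w"
proof -
  let ?S = "\<lambda>u. sum_list (map (\<lambda>c. occurrences w (\<eta> c)) u)"
  have "?S u \<le> occurrences w (subst_ext \<eta> u)
      \<and> occurrences w (subst_ext \<eta> u) \<le> ?S u + length u * length w"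
  proof (induction u)
    case (Cons a u)
    then show ?case
      using occurrences_append[OF assms, of "\<eta> a" "subst_ext \<eta> u"]
      by (auto simp: subst_ext_Cons)
  qed (simp add: occurrences_Nil[OF assms])
  then show "(\<Sum>c\<in>UNIV. count_list u c * occurrences w (\<eta> c)) \<le> occurrences w (subst_ext \<eta> u)"
    and "occurrences w (subst_ext \<eta> u)
      \<le> (\<Sum>c\<in>UNIV. count_list u c * occurrences w (\<eta> c)) + length u * length w"
    by (simp_all only: sum_list_letters)
qed

lemma convergent_of_approximations:
  fixes z :: "nat \<Rightarrow> real"
  assumes "\<And>\<epsilon>. 0 < \<epsilon> \<Longrightarrow> \<exists>y m. convergent y \<and> (\<forall>t. \<bar>z (m + t) - y t\<bar> \<le> \<epsilon>)"
  shows "convergent z"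
  unfolding Cauchy_convergent_iff[symmetric]
proof (rule CauchyI)
  fix \<epsilon> :: real assume "0 < \<epsilon>"
  then obtain y m where y: "convergent y" and close: "\<And>t. \<bar>z (m + t) - y t\<bar> \<le> \<epsilon> / 4"
    using assms[of "\<epsilon> / 4"] by auto
  obtain M where M: "\<And>i j. M \<le> i \<Longrightarrow> M \<le> j \<Longrightarrow> \<bar>y i - y j\<bar> < \<epsilon> / 4"
    using CauchyD[of y "\<epsilon> / 4"] y \<open>0 < \<epsilon>\<close> by (auto simp: Cauchy_convergent_iff)
  show "\<exists>M. \<forall>i\<ge>M. \<forall>j\<ge>M. norm (z i - z j) < \<epsilon>"
  proof (intro exI[of _ "m + M"] allI impI)
    fix i j assume "m + M \<le> i" "m + M \<le> j"
    then obtain i' j' where ij: "i = m + (M + i')" "j = m + (M + j')"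
      by (auto simp: le_iff_add add.assoc)
    have "norm (z i - z j) \<le> \<bar>z i - y (M + i')\<bar> + \<bar>y (M + i') - y (M + j')\<bar> + \<bar>z j - y (M + j')\<bar>"
      by simp
    also have "\<dots> < \<epsilon>"
      using close[of "M + i'"] close[of "M + j'"] M[of "M + i'" "M + j'"] \<open>0 < \<epsilon>\<close> unfolding ij by simp
    finally show "norm (z i - z j) < \<epsilon>" .
  qed
qed

text \<open>For large \<open>m\<close> the frequency of \<open>w\<close> in
  \<open>\<zeta>\<^bsup>m+t\<^esup>(a)\<close> is, uniformly in \<open>t\<close>, close to the share
  of the occurrences inside the blocks \<open>\<zeta>\<^sup>m(c)\<close>. This share is a quotient
  of two linear combinations, with constant coefficients, of the letter frequencies of
  \<open>\<zeta>\<^sup>t(a)\<close>, hence converges as \<open>t\<close> grows.\<close>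

lemma factor_frequencies_converge:
  fixes \<zeta> :: "('a::finite) substitution"
  assumes letters: "\<And>b. convergent (\<lambda>t. real (count_list (subst_power \<zeta> t a) b) / real (length (subst_power \<zeta> t a)))"
    and nonempty: "\<And>t a. 0 < length (subst_power \<zeta> t a)"
    and unbounded: "\<And>K. \<exists>t. \<forall>a. K \<le> length (subst_power \<zeta> t a)"
    and w: "w \<noteq> []"
  shows "convergent (\<lambda>t. real (occurrences w (subst_power \<zeta> t a)) / real (length (subst_power \<zeta> t a)))"
proof (rule convergent_of_approximations)
  fix \<epsilon> :: real assume "0 < \<epsilon>"
  \<comment> \<open>Blocks of length at least \<open>K\<close> keep the straddling occurrences below the fraction \<open>\<epsilon>\<close>.\<close>
  obtain K :: nat where K: "real (length w) / \<epsilon> < real K" using reals_Archimedean2 by blast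
  moreover have "0 \<le> real (length w) / \<epsilon>" using \<open>0 < \<epsilon>\<close> by simp
  ultimately have K0: "0 < real K" by linarith
  obtain m where m: "\<And>c. K \<le> length (subst_power \<zeta> m c)" using unbounded[of K] by blast
  define len where "len t = real (length (subst_power \<zeta> t a))" for t
  define f where "f t c = real (count_list (subst_power \<zeta> t a) c)" for t c
  define N where "N c = real (occurrences w (subst_power \<zeta> m c))" for c
  define D where "D c = real (length (subst_power \<zeta> m c))" for c
  define y where "y t = (\<Sum>c\<in>UNIV. f t c * N c) / (\<Sum>c\<in>UNIV. f t c * D c)" for t
  have len_pos: "0 < len t" for t using nonempty by (simp add: len_def)
  have D_K: "real K \<le> D c" for c using m by (simp add: D_def)
  have total: "(\<Sum>c\<in>UNIV. f t c) = len t" for t by (simp add: f_def len_def length_eq_sum_count)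
  have denom: "real K * len t \<le> (\<Sum>c\<in>UNIV. f t c * D c)" for t
    unfolding total[symmetric] sum_distrib_left
    using D_K by (intro sum_mono) (simp add: f_def mult.commute mult_right_mono)
  have "convergent y"
  proof -
    define \<phi> where "\<phi> c = lim (\<lambda>t. f t c / len t)" for c
    have \<phi>: "(\<lambda>t. f t c / len t) \<longlonglongrightarrow> \<phi> c" for c
      using letters unfolding \<phi>_def f_def len_def convergent_LIMSEQ_iff .
    have num: "(\<lambda>t. \<Sum>c\<in>UNIV. f t c / len t * N c) \<longlonglongrightarrow> (\<Sum>c\<in>UNIV. \<phi> c * N c)"
      by (intro tendsto_intros \<phi>)
    have den: "(\<lambda>t. \<Sum>c\<in>UNIV. f t c / len t * D c) \<longlonglongrightarrow> (\<Sum>c\<in>UNIV. \<phi> c * D c)"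
      by (intro tendsto_intros \<phi>)
    have scale: "(\<Sum>c\<in>UNIV. f t c / len t * g c) = (\<Sum>c\<in>UNIV. f t c * g c) / len t" for t g
      by (simp add: sum_divide_distrib)
    have "real K \<le> (\<Sum>c\<in>UNIV. f t c / len t * D c)" for t
      using denom[of t] len_pos[of t] unfolding scale by (simp add: le_divide_eq)
    then have "real K \<le> (\<Sum>c\<in>UNIV. \<phi> c * D c)"
      using den by (intro LIMSEQ_le_const) auto
    then have "(\<lambda>t. (\<Sum>c\<in>UNIV. f t c / len t * N c) / (\<Sum>c\<in>UNIV. f t c / len t * D c))
        \<longlonglongrightarrow> (\<Sum>c\<in>UNIV. \<phi> c * N c) / (\<Sum>c\<in>UNIV. \<phi> c * D c)"
      using K0 by (intro tendsto_divide num den) auto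
    moreover have "(\<Sum>c\<in>UNIV. f t c / len t * N c) / (\<Sum>c\<in>UNIV. f t c / len t * D c) = y t" for t
      using len_pos[of t] unfolding scale by (simp add: y_def)
    ultimately show ?thesis by (auto intro: convergentI)
  qed
  moreover have "\<bar>real (occurrences w (subst_power \<zeta> (m + t) a)) / real (length (subst_power \<zeta> (m + t) a)) - y t\<bar> \<le> \<epsilon>" for t
  proof -
    define S where "S = (\<Sum>c\<in>UNIV. f t c * N c)"
    define T where "T = (\<Sum>c\<in>UNIV. f t c * D c)"
    have image_len: "real (length (subst_power \<zeta> (m + t) a)) = T"
      by (simp add: subst_power_add length_subst_ext T_def f_def D_def)
    have "0 < T" using denom[of t] K0 len_pos[of t] unfolding T_def
      by (meson less_le_trans mult_pos_pos)
    have S: "S = real (\<Sum>c\<in>UNIV. count_list (subst_power \<zeta> t a) c * occurrences w (subst_power \<zeta> m c))"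
      by (simp add: S_def f_def N_def)
    have occ: "S \<le> real (occurrences w (subst_power \<zeta> (m + t) a))"
      "real (occurrences w (subst_power \<zeta> (m + t) a)) \<le> S + len t * real (length w)"
      using occurrences_subst_ext[OF w, where u = "subst_power \<zeta> t a" and \<eta> = "subst_power \<zeta> m"]
      unfolding S subst_power_add len_def of_nat_mult[symmetric] of_nat_add[symmetric] of_nat_le_iff .
    have "len t * real (length w) \<le> len t * (\<epsilon> * real K)"
      using K \<open>0 < \<epsilon>\<close> len_pos[of t] by (intro mult_left_mono) (auto simp: divide_less_eq mult.commute)
    also have "\<dots> \<le> \<epsilon> * T"
      using mult_left_mono[OF denom[of t], of \<epsilon>] \<open>0 < \<epsilon>\<close> by (simp add: T_def mult_ac)
    finally have "\<bar>real (occurrences w (subst_power \<zeta> (m + t) a)) - S\<bar> \<le> \<epsilon> * T" using occ by simp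
    then have "\<bar>real (occurrences w (subst_power \<zeta> (m + t) a)) - S\<bar> / T \<le> \<epsilon>"
      using \<open>0 < T\<close> by (simp add: divide_le_eq)
    moreover have "\<bar>real (occurrences w (subst_power \<zeta> (m + t) a)) - S\<bar> / T
        = \<bar>real (occurrences w (subst_power \<zeta> (m + t) a)) / T - S / T\<bar>"
      using \<open>0 < T\<close> by (simp add: abs_divide flip: diff_divide_distrib)
    ultimately show ?thesis unfolding image_len y_def S_def[symmetric] T_def[symmetric] by simp
  qed
  ultimately show "\<exists>y m. convergent y \<and> (\<forall>t. \<bar>real (occurrences w (subst_power \<zeta> (m + t) a))
      / real (length (subst_power \<zeta> (m + t) a)) - y t\<bar> \<le> \<epsilon>)"
    by blast
qed

theorem theorem1p2:
  fixes \<xi> :: "('a::finite) substitution"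
  assumes "expanding \<xi>"
  shows "\<exists>s\<ge>1. \<exists>\<zeta>. \<zeta> = subst_power \<xi> s \<and>
           (\<forall>w a. w \<noteq> [] \<longrightarrow>
              convergent (\<lambda>t. real (occurrences w (subst_power \<zeta> t a))
                              / real (length (subst_power \<zeta> t a))))"
proof -
  obtain s where s: "1 \<le> s"
    and loops: "\<And>k l. 1 \<le> l \<Longrightarrow> k \<in> set (subst_power \<xi> l k) \<Longrightarrow> k \<in> set (subst_power \<xi> s k)"
    by (rule exists_loop_power[of \<xi>]) (rule that)
  define \<zeta> where "\<zeta> = subst_power \<xi> s"
  have nonempty: "0 < length (subst_power \<zeta> t a)" for t a
    unfolding \<zeta>_def subst_power_power using assms by (rule expanding_nonerasing)
  have "k \<in> set (\<zeta> k)" if "1 \<le> l" "k \<in> set (subst_power \<zeta> l k)" for k l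
    using loops[of "s * l" k] that s unfolding \<zeta>_def subst_power_power by simp
  then have "convergent (\<lambda>t. real (count_list (subst_power \<zeta> t a) b) / real (length (subst_power \<zeta> t a)))"
    for a b
    using nonempty by (rule letter_frequencies_converge)
  then have "convergent (\<lambda>t. real (occurrences w (subst_power \<zeta> t a)) / real (length (subst_power \<zeta> t a)))"
    if "w \<noteq> []" for w a
    using nonempty expanding_lengths_unbounded[OF assms s, folded \<zeta>_def] that
    by (rule factor_frequencies_converge)
  then show ?thesis using s \<zeta>_def by blast
qed

end
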